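(* Let $A,B\in\mathrm{SL}_2\mathbb{Z}$ be noncommuting, well oriented, with $2\le\mathrm{tr}(A)<\mathrm{tr}(B)$. Then for all words $w,u$ (possibly empty): (1) $[w]<[u]$ if and only if $[w]\le[u]-1$; (2) if $u$ is a subword of $w$, then $[u]<[w]$, except in the case in which $A$ is parabolic and $w$ is a power of $a$.
   Context: Words are finite (possibly empty) strings over $\{a,b\}$; $\phi$ is the monoid homomorphism with $\phi(a)=A$, $\phi(b)=B$, and $[w]=\mathrm{tr}(\phi(w))$ (so the empty word has $[\,]=2$). A subword of $w$ is a possibly empty word obtained from $w$ by deleting one or more not necessarily contiguous letters. $A$ is parabolic if $\mathrm{tr}(A)=2$. Fixed points are for the Möbius action on $\partial\mathcal{H}=\mathbb{P}^1\mathbb{R}$; $\alpha^\pm$ ($\beta^\pm$) are the attracting/repelling fixed points of $A$ ($B$), both equal to the unique fixed point if parabolic. With $\partial\mathcal{H}$ cyclically ordered and $[\alpha,\beta]$ the closed counterclockwise interval from $\alpha$ to $\beta$, let $I^+=\{\alpha^+\}$ if $\alpha^+=\beta^+$, and otherwise the one of $[\alpha^+,\beta^+],[\beta^+,\alpha^+]$ mapped into itself by both $A$ and $B$ (if it exists); define $I^-$ likewise with $A^{-1},B^{-1},\alpha^-,\beta^-$. The pair is coherently oriented if both exist, and well oriented if $A,B$ is coherently oriented but $A,B^{-1}$ is not. *)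

theory Defs
  imports "HOL-Analysis.Analysis" "HOL-Library.Sublist"
begin

section \<open>Words and the trace map\<close>

datatype letter = La | Lb

type_synonym word = "letter list"

definition letter_mat :: "int^2^2 \<Rightarrow> int^2^2 \<Rightarrow> letter \<Rightarrow> int^2^2" where
  "letter_mat A B l = (case l of La \<Rightarrow> A | Lb \<Rightarrow> B)"

text \<open>The monoid homomorphism phi with phi(a)=A, phi(b)=B (empty word goes to identity).\<close>
definition phi :: "int^2^2 \<Rightarrow> int^2^2 \<Rightarrow> word \<Rightarrow> int^2^2" where
  "phi A B w = foldr (\<lambda>l M. letter_mat A B l ** M) w (mat 1)"

text \<open>[w] = tr(phi(w)).\<close>
definition trw :: "int^2^2 \<Rightarrow> int^2^2 \<Rightarrow> word \<Rightarrow> int" where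
  "trw A B w = trace (phi A B w)"

section \<open>SL2(Z) and inverses\<close>

definition SL2Z :: "int^2^2 \<Rightarrow> bool" where
  "SL2Z M \<longleftrightarrow> det M = 1"

text \<open>Inverse of a determinant-one 2x2 matrix (the adjugate).\<close>
definition inv2 :: "int^2^2 \<Rightarrow> int^2^2" where
  "inv2 M = (\<chi> i j. if i = 1 \<and> j = 1 then M$2$2 else if i = 1 \<and> j = 2 then - M$1$2
                  else if i = 2 \<and> j = 1 then - M$2$1 else M$1$1)"

section \<open>The real projective line and the Moebius action\<close>

datatype proj = Fin real | Inf

definition mob :: "int^2^2 \<Rightarrow> proj \<Rightarrow> proj" where
  "mob M z = (let p = real_of_int (M$1$1); q = real_of_int (M$1$2);
                  r = real_of_int (M$2$1); s = real_of_int (M$2$2) in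
     (case z of
        Fin x \<Rightarrow> (if r * x + s \<noteq> 0 then Fin ((p * x + q) / (r * x + s)) else Inf)
      | Inf \<Rightarrow> (if r \<noteq> 0 then Fin (p / r) else Inf)))"

text \<open>Convergence of sequences in P^1(R) (one-point compactification of R).\<close>
definition pconv :: "(nat \<Rightarrow> proj) \<Rightarrow> proj \<Rightarrow> bool" where
  "pconv f z = (case z of
      Fin x \<Rightarrow> (\<forall>e>0. \<exists>N. \<forall>n\<ge>N. \<exists>t. f n = Fin t \<and> \<bar>t - x\<bar> < e)
    | Inf \<Rightarrow> (\<forall>K. \<exists>N. \<forall>n\<ge>N. f n = Inf \<or> (\<exists>t. f n = Fin t \<and> \<bar>t\<bar> > K)))"

text \<open>Attracting fixed point: the fixed point to which the forward orbit of every
  non-fixed point converges (for parabolic M this is the unique fixed point).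
  Repelling fixed point: attracting fixed point of the inverse.\<close>
definition att_fp :: "int^2^2 \<Rightarrow> proj" where
  "att_fp M = (THE x. mob M x = x \<and>
       (\<forall>y. mob M y \<noteq> y \<longrightarrow> pconv (\<lambda>n. (mob M ^^ n) y) x))"

definition rep_fp :: "int^2^2 \<Rightarrow> proj" where
  "rep_fp M = att_fp (inv2 M)"

text \<open>Closed counterclockwise interval from x to y on the boundary circle
  (counterclockwise = increasing along R, then through infinity).\<close>
fun ccw_int :: "proj \<Rightarrow> proj \<Rightarrow> proj set" where
  "ccw_int (Fin x) (Fin y) =
     (if x \<le> y then {Fin t | t. x \<le> t \<and> t \<le> y}
      else insert Inf {Fin t | t. x \<le> t \<or> t \<le> y})"
| "ccw_int (Fin x) Inf = insert Inf {Fin t | t. x \<le> t}"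
| "ccw_int Inf (Fin y) = insert Inf {Fin t | t. t \<le> y}"
| "ccw_int Inf Inf = {Inf}"

definition invariant2 :: "int^2^2 \<Rightarrow> int^2^2 \<Rightarrow> proj set \<Rightarrow> bool" where
  "invariant2 A B I \<longleftrightarrow> mob A ` I \<subseteq> I \<and> mob B ` I \<subseteq> I"

text \<open>Existence of I^+ (resp. I^-): either the attracting (repelling) fixed points
  coincide, or one of the two closed arcs between them is mapped into itself by
  both A and B (resp. A^-1 and B^-1).\<close>
definition Iplus_exists :: "int^2^2 \<Rightarrow> int^2^2 \<Rightarrow> bool" where
  "Iplus_exists A B \<longleftrightarrow> att_fp A = att_fp B \<or>
     invariant2 A B (ccw_int (att_fp A) (att_fp B)) \<or>
     invariant2 A B (ccw_int (att_fp B) (att_fp A))"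

definition Iminus_exists :: "int^2^2 \<Rightarrow> int^2^2 \<Rightarrow> bool" where
  "Iminus_exists A B \<longleftrightarrow> rep_fp A = rep_fp B \<or>
     invariant2 (inv2 A) (inv2 B) (ccw_int (rep_fp A) (rep_fp B)) \<or>
     invariant2 (inv2 A) (inv2 B) (ccw_int (rep_fp B) (rep_fp A))"

definition coherently_oriented :: "int^2^2 \<Rightarrow> int^2^2 \<Rightarrow> bool" where
  "coherently_oriented A B \<longleftrightarrow> Iplus_exists A B \<and> Iminus_exists A B"

definition well_oriented :: "int^2^2 \<Rightarrow> int^2^2 \<Rightarrow> bool" where
  "well_oriented A B \<longleftrightarrow> coherently_oriented A B \<and> \<not> coherently_oriented A (inv2 B)"

definition parabolic :: "int^2^2 \<Rightarrow> bool" where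
  "parabolic M \<longleftrightarrow> trace M = 2"

end

theory Submission
  imports Defs
begin

text \<open>
  Write \<open>tr A = \<lambda> + 1/\<lambda>\<close> and \<open>tr B = \<mu> + 1/\<mu>\<close> with \<open>\<lambda> \<ge> 1\<close> and \<open>\<mu> > 1\<close>.
  Noncommuting integer matrices with \<open>tr B \<noteq> \<plusminus>2\<close> have no common eigenvector (its
  direction would be rational, and so would the corresponding eigenvalue of \<open>B\<close>), so the
  repelling eigenvectors of \<open>A\<close> and \<open>B\<close> form a basis in which \<open>A = (\<lambda>, 0; r, 1/\<lambda>)\<close> and
  \<open>B = (1/\<mu>, q; 0, \<mu>)\<close> with \<open>r > 0\<close>. The arcs between fixed points are projectivised cones, and
  comparing them shows that well-orientation forces \<open>q > 0\<close> and \<open>al < be\<close>, where \<open>(al, 1)\<close>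
  and \<open>(be, 1)\<close> are the attracting eigendirections of \<open>A\<close> and \<open>B\<close>. Then \<open>A\<close>, \<open>B\<close> and
  all their products are nonnegative and preserve the cones \<open>x \<ge> al y \<ge> 0\<close> and
  \<open>0 \<le> x \<le> be y\<close>; for such a product \<open>M\<close> this gives \<open>tr(A M) \<ge> tr M\<close> and
  \<open>tr(B M) > tr M\<close>, strictly unless \<open>A\<close> is parabolic and \<open>M\<close> is a power of \<open>A\<close>. Since traces
  are invariant under rotation of words, inserting a letter anywhere into a word does not
  decrease its trace, and deleting the extra letters of a word one at a time gives (2);
  (1) holds because traces are integers.
\<close>

section \<open>Two-by-two matrices\<close>

lemma vec2_eq_iff: "(u::'a^2) = v \<longleftrightarrow> u$1 = v$1 \<and> u$2 = v$2"
  by (simp add: vec_eq_iff forall_2)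

lemma mat2_eq_iff:
  "(X::'a^2^2) = Y \<longleftrightarrow> X$1$1 = Y$1$1 \<and> X$1$2 = Y$1$2 \<and> X$2$1 = Y$2$1 \<and> X$2$2 = Y$2$2"
  by (metis vec2_eq_iff)

lemma matrix_vector_mult_2 [simp]:
  "((X::'a::comm_semiring_1^2^2) *v u)$i = X$i$1 * u$1 + X$i$2 * u$2"
  by (simp add: matrix_vector_mult_def sum_2)

lemma matrix_matrix_mult_2 [simp]:
  "((X::'a::comm_semiring_1^2^2) ** Y)$i$j = X$i$1 * Y$1$j + X$i$2 * Y$2$j"
  by (simp add: matrix_matrix_mult_def sum_2)

lemma trace_2: "trace (X::'a::comm_semiring_1^2^2) = X$1$1 + X$2$2"
  by (simp add: trace_def sum_2)

lemma mat_1_nth: "(mat 1 :: 'a::zero_neq_one^2^2)$i$j = (if i = j then 1 else 0)"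
  by (simp add: mat_def)

lemma cayley_hamilton_2:
  "(X::real^2^2) *v (X *v v) = trace X *\<^sub>R (X *v v) - det X *\<^sub>R v"
  by (simp add: vec2_eq_iff det_2 trace_2 algebra_simps)

lemma matrix_vector_mult_eq_0_iff:
  assumes "det (X::real^2^2) \<noteq> 0"
  shows "X *v u = 0 \<longleftrightarrow> u = 0"
proof
  assume "X *v u = 0"
  then have e: "X$1$1 * u$1 + X$1$2 * u$2 = 0" "X$2$1 * u$1 + X$2$2 * u$2 = 0"
    by (simp_all add: vec2_eq_iff)
  have "det X * u$1 = X$2$2 * (X$1$1 * u$1 + X$1$2 * u$2) - X$1$2 * (X$2$1 * u$1 + X$2$2 * u$2)"
    "det X * u$2 = X$1$1 * (X$2$1 * u$1 + X$2$2 * u$2) - X$2$1 * (X$1$1 * u$1 + X$1$2 * u$2)"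
    by (simp_all add: det_2 algebra_simps)
  then have "det X * u$1 = 0" "det X * u$2 = 0"
    by (simp_all only: e mult_zero_right diff_self)
  then show "u = 0" using assms by (simp add: vec2_eq_iff)
qed simp

lemma matrix_vector_mult_uminus_right: "(X::real^2^2) *v (- u) = - (X *v u)"
  by (simp add: vec2_eq_iff)

definition mat2 :: "real \<Rightarrow> real \<Rightarrow> real \<Rightarrow> real \<Rightarrow> real^2^2" where
  "mat2 a b c d = vector [vector [a, b], vector [c, d]]"

lemma mat2_nth [simp]:
  "mat2 a b c d $1$1 = a" "mat2 a b c d $1$2 = b" "mat2 a b c d $2$1 = c" "mat2 a b c d $2$2 = d"
  by (simp_all add: mat2_def)

definition real_mat :: "int^2^2 \<Rightarrow> real^2^2" where
  "real_mat M = (\<chi> i j. real_of_int (M$i$j))"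

lemma real_mat_nth [simp]: "real_mat M $ i $ j = real_of_int (M$i$j)"
  by (simp add: real_mat_def)

lemma real_mat_mult: "real_mat (M ** N) = real_mat M ** real_mat N"
  by (simp add: mat2_eq_iff)

lemma real_mat_1: "real_mat (mat 1) = mat 1"
  by (simp add: mat2_eq_iff mat_1_nth)

lemma real_mat_eq_1_iff: "real_mat M = mat 1 \<longleftrightarrow> M = mat 1"
  by (auto simp: mat2_eq_iff mat_1_nth)

lemma det_real_mat: "det (real_mat M) = real_of_int (det M)"
  by (simp add: det_2)

lemma trace_real_mat: "trace (real_mat M) = real_of_int (trace M)"
  by (simp add: trace_2)

lemma SL2Z_det_real_mat: "SL2Z M \<Longrightarrow> det (real_mat M) = 1"
  by (simp add: det_real_mat SL2Z_def)

lemma inv2_nth [simp]: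
  "inv2 M $1$1 = M$2$2" "inv2 M $1$2 = - M$1$2" "inv2 M $2$1 = - M$2$1" "inv2 M $2$2 = M$1$1"
  by (simp_all add: inv2_def)

lemma SL2Z_inv2: "SL2Z M \<Longrightarrow> SL2Z (inv2 M)"
  by (simp add: SL2Z_def det_2 algebra_simps)

lemma trace_inv2: "trace (inv2 M) = trace M"
  by (simp add: trace_2)

lemma inv2_inv2 [simp]: "inv2 (inv2 M) = M"
  by (simp add: mat2_eq_iff)

lemma inv2_eq_1_iff: "inv2 M = mat 1 \<longleftrightarrow> M = mat 1"
  by (auto simp: mat2_eq_iff mat_1_nth)

lemma real_mat_inv2_eqI:
  assumes "SL2Z M" and "real_mat M *v x = y"
  shows "real_mat (inv2 M) *v y = x"
proof -
  have "real_of_int (M$1$1 * M$2$2 - M$1$2 * M$2$1) = 1"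
    using assms(1) by (simp add: SL2Z_def det_2)
  then have "real_mat (inv2 M) *v (real_mat M *v x) = x"
    by (simp add: vec2_eq_iff algebra_simps)
  with assms(2) show ?thesis by simp
qed

lemma real_mat_inv2_eigenvector:
  assumes "SL2Z M" "real_mat M *v v = c *\<^sub>R v" "c \<noteq> 0"
  shows "real_mat (inv2 M) *v v = (1/c) *\<^sub>R v"
proof (rule real_mat_inv2_eqI[OF assms(1)])
  show "real_mat M *v ((1/c) *\<^sub>R v) = v"
    using assms(2,3) by (simp add: matrix_vector_mult_scaleR del: matrix_vector_mult_2)
qed

section \<open>The cross product of plane vectors\<close>

definition cross2 :: "real^2 \<Rightarrow> real^2 \<Rightarrow> real" where
  "cross2 u v = u$1 * v$2 - u$2 * v$1"

lemma cross2_simps [simp]: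
  "cross2 u u = 0"
  "cross2 (x + y) w = cross2 x w + cross2 y w" "cross2 w (x + y) = cross2 w x + cross2 w y"
  "cross2 (x - y) w = cross2 x w - cross2 y w" "cross2 w (x - y) = cross2 w x - cross2 w y"
  "cross2 (a *\<^sub>R x) w = a * cross2 x w" "cross2 w (a *\<^sub>R x) = a * cross2 w x"
  "cross2 (- x) w = - cross2 x w" "cross2 w (- x) = - cross2 w x"
  "cross2 0 w = 0" "cross2 w 0 = 0"
  by (simp_all add: cross2_def algebra_simps)

lemma cross2_commute: "cross2 u v = - cross2 v u"
  by (simp add: cross2_def)

lemma cross2_matrix_vector_mult: "cross2 (X *v u) (X *v v) = det X * cross2 u v"
  by (simp add: cross2_def det_2 algebra_simps)

lemma cross2_nonzero_imp_nonzero: "cross2 u v \<noteq> 0 \<Longrightarrow> u \<noteq> 0 \<and> v \<noteq> 0"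
  by (auto simp: cross2_def)

lemma cross2_coordinates:
  assumes "cross2 P Q \<noteq> 0"
  shows "u = (cross2 u Q / cross2 P Q) *\<^sub>R P + (cross2 P u / cross2 P Q) *\<^sub>R Q"
proof -
  have "cross2 u Q * P$1 + cross2 P u * Q$1 = cross2 P Q * u$1"
    "cross2 u Q * P$2 + cross2 P u * Q$2 = cross2 P Q * u$2"
    by (simp_all add: cross2_def algebra_simps)
  then show ?thesis
    using assms by (simp add: vec2_eq_iff field_simps)
qed

lemma cross2_eq_0_imp_parallel:
  assumes "u \<noteq> 0" and "cross2 u v = 0"
  shows "\<exists>k. v = k *\<^sub>R u"
proof (cases "u$1 = 0")
  case True
  with assms have "u$2 \<noteq> 0" "v$1 = 0" by (auto simp: cross2_def vec2_eq_iff)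
  then have "v = (v$2 / u$2) *\<^sub>R u" using True by (simp add: vec2_eq_iff)
  then show ?thesis by blast
next
  case False
  then have "v = (v$1 / u$1) *\<^sub>R u"
    using assms(2) by (simp add: vec2_eq_iff cross2_def field_simps)
  then show ?thesis by blast
qed

lemma eigenvector_parallel:
  assumes "v \<noteq> 0" and "X *v v = c *\<^sub>R v" and "cross2 v u = 0"
  shows "X *v u = c *\<^sub>R u"
proof -
  obtain k where "u = k *\<^sub>R v" using cross2_eq_0_imp_parallel assms(1,3) by blast
  then show ?thesis by (simp add: assms(2) matrix_vector_mult_scaleR del: matrix_vector_mult_2)
qed

lemma eigenbasis_action:
  assumes "det X = 1" and D: "cross2 v w \<noteq> 0" and Xw: "X *v w = c *\<^sub>R w"
  shows "X *v v = (1/c) *\<^sub>R v + (cross2 v (X *v v) / cross2 v w) *\<^sub>R w"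
proof -
  have "c * cross2 (X *v v) w = cross2 v w"
    using cross2_matrix_vector_mult[of X v w] assms(1) Xw by simp
  moreover from this D have "c \<noteq> 0" by auto
  ultimately have "cross2 (X *v v) w / cross2 v w = 1/c"
    using D by (simp add: field_simps)
  then show ?thesis
    using cross2_coordinates[OF D, of "X *v v"] by simp
qed

lemma eigenbasis_action_pos:
  assumes "det X = 1" and D: "cross2 b a \<noteq> 0" and Xa: "X *v a = c *\<^sub>R a"
    and "cross2 b (X *v b) \<noteq> 0"
  obtains b' r where "b' = b \<or> b' = - b" "r > 0" "X *v b' = (1/c) *\<^sub>R b' + r *\<^sub>R a"
proof -
  define r where "r = cross2 b (X *v b) / cross2 b a"
  have Xb: "X *v b = (1/c) *\<^sub>R b + r *\<^sub>R a"
    using eigenbasis_action[OF assms(1) D Xa] by (simp add: r_def)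
  moreover have "X *v (- b) = (1/c) *\<^sub>R (- b) + (- r) *\<^sub>R a"
    using Xb by (simp add: matrix_vector_mult_uminus_right del: matrix_vector_mult_2)
  moreover have "r \<noteq> 0" using assms(4) D by (simp add: r_def)
  ultimately show ?thesis
    using that by (metis neg_0_less_iff_less linorder_neqE_linordered_idom)
qed

section \<open>The real projective line\<close>

definition proj_of :: "real^2 \<Rightarrow> proj" where
  "proj_of u = (if u$2 \<noteq> 0 then Fin (u$1 / u$2) else Inf)"

definition vec_of_proj :: "proj \<Rightarrow> real^2" where
  "vec_of_proj z = (case z of Fin x \<Rightarrow> vector [x, 1] | Inf \<Rightarrow> vector [1, 0])"

definition mob_real :: "real^2^2 \<Rightarrow> proj \<Rightarrow> proj" where
  "mob_real X z = proj_of (X *v vec_of_proj z)"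

lemma mob_eq_mob_real: "mob M = mob_real (real_mat M)"
  by (auto simp: fun_eq_iff mob_def mob_real_def proj_of_def vec_of_proj_def Let_def
      split: proj.splits)

lemma proj_of_scaleR: "c \<noteq> 0 \<Longrightarrow> proj_of (c *\<^sub>R u) = proj_of u"
  by (simp add: proj_of_def)

lemma proj_of_uminus: "proj_of (- u) = proj_of u"
  using proj_of_scaleR[of "-1" u] by simp

lemma proj_of_vec_of_proj [simp]: "proj_of (vec_of_proj z) = z"
  by (cases z) (auto simp: proj_of_def vec_of_proj_def)

lemma vec_of_proj_nonzero [simp]: "vec_of_proj z \<noteq> 0"
  by (cases z) (auto simp: vec2_eq_iff vec_of_proj_def)

lemma vec_of_proj_of:
  assumes "u \<noteq> 0"
  obtains c where "c \<noteq> 0" "vec_of_proj (proj_of u) = c *\<^sub>R u"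
proof (cases "u$2 = 0")
  case True
  with assms have "u$1 \<noteq> 0" by (simp add: vec2_eq_iff)
  with True show ?thesis
    by (intro that[of "1 / u$1"]) (auto simp: proj_of_def vec_of_proj_def vec2_eq_iff)
next
  case False
  then show ?thesis
    by (intro that[of "1 / u$2"]) (auto simp: proj_of_def vec_of_proj_def vec2_eq_iff)
qed

lemma proj_of_eq_iff:
  "u \<noteq> 0 \<Longrightarrow> v \<noteq> 0 \<Longrightarrow> proj_of u = proj_of v \<longleftrightarrow> cross2 u v = 0"
  by (auto simp: proj_of_def cross2_def vec2_eq_iff field_simps split: if_splits)

lemma mob_real_proj_of:
  assumes "u \<noteq> 0"
  shows "mob_real X (proj_of u) = proj_of (X *v u)"
proof -
  obtain c where "c \<noteq> 0" "vec_of_proj (proj_of u) = c *\<^sub>R u"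
    using vec_of_proj_of[OF assms] .
  then show ?thesis
    by (simp add: mob_real_def matrix_vector_mult_scaleR proj_of_scaleR del: matrix_vector_mult_2)
qed

lemma funpow_mob_real:
  assumes "det X \<noteq> 0" and "u \<noteq> 0"
  shows "(mob_real X ^^ n) (proj_of u) = proj_of (((*v) X ^^ n) u)"
proof (induction n)
  case (Suc n)
  have "((*v) X ^^ n) u \<noteq> 0"
    by (induction n) (use assms in \<open>simp_all add: matrix_vector_mult_eq_0_iff del: matrix_vector_mult_2\<close>)
  with Suc show ?case by (simp add: mob_real_proj_of)
qed simp

section \<open>Convergence on the projective line\<close>

lemma pconv_Fin_iff:
  "pconv f (Fin a) \<longleftrightarrow> (\<forall>e>0. \<forall>\<^sub>F n in sequentially. \<exists>t. f n = Fin t \<and> \<bar>t - a\<bar> < e)"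
  by (simp add: pconv_def eventually_sequentially)

lemma pconv_Inf_iff:
  "pconv f Inf \<longleftrightarrow> (\<forall>K. \<forall>\<^sub>F n in sequentially. f n = Inf \<or> (\<exists>t. f n = Fin t \<and> \<bar>t\<bar> > K))"
  by (simp add: pconv_def eventually_sequentially)

lemma pconv_Fin_Inf: "\<not> (pconv f (Fin a) \<and> pconv f Inf)"
proof
  assume "pconv f (Fin a) \<and> pconv f Inf"
  then have "\<forall>\<^sub>F n in sequentially. (\<exists>t. f n = Fin t \<and> \<bar>t - a\<bar> < 1) \<and>
      (f n = Inf \<or> (\<exists>t. f n = Fin t \<and> \<bar>t\<bar> > \<bar>a\<bar> + 1))"
    by (intro eventually_conj) (simp_all add: pconv_Fin_iff pconv_Inf_iff)
  then obtain n where "(\<exists>t. f n = Fin t \<and> \<bar>t - a\<bar> < 1) \<and>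
      (f n = Inf \<or> (\<exists>t. f n = Fin t \<and> \<bar>t\<bar> > \<bar>a\<bar> + 1))"
    using eventually_happens'[OF sequentially_bot] by blast
  then show False by auto
qed

lemma pconv_unique:
  assumes "pconv f x" and "pconv f y"
  shows "x = y"
proof (cases x; cases y)
  fix a b assume x: "x = Fin a" and y: "y = Fin b"
  show "x = y"
  proof (rule ccontr)
    define d where "d = \<bar>a - b\<bar>"
    assume "x \<noteq> y"
    then have "d / 2 > 0" using x y by (auto simp: d_def)
    then have "\<forall>\<^sub>F n in sequentially. \<exists>t. f n = Fin t \<and> \<bar>t - a\<bar> < d / 2"
      "\<forall>\<^sub>F n in sequentially. \<exists>t. f n = Fin t \<and> \<bar>t - b\<bar> < d / 2"
      using assms unfolding x y pconv_Fin_iff by blast+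
    then obtain n where "(\<exists>t. f n = Fin t \<and> \<bar>t - a\<bar> < d / 2) \<and> (\<exists>t. f n = Fin t \<and> \<bar>t - b\<bar> < d / 2)"
      using eventually_happens'[OF sequentially_bot eventually_conj] by blast
    then obtain t where "\<bar>t - a\<bar> < d / 2" "\<bar>t - b\<bar> < d / 2"
      by auto
    moreover have "d \<le> \<bar>t - b\<bar> + \<bar>t - a\<bar>"
      using abs_triangle_ineq4[of "t - b" "t - a"] by (simp add: d_def)
    ultimately show False by linarith
  qed
qed (use assms pconv_Fin_Inf in auto)

lemma pconv_Fin_of_tendsto:
  assumes g: "g \<longlonglongrightarrow> e" and "e$2 \<noteq> 0" and f: "\<forall>\<^sub>F n in sequentially. f n = proj_of (g n)"
  shows "pconv f (Fin (e$1 / e$2))"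
  unfolding pconv_Fin_iff
proof (intro allI impI)
  fix \<epsilon> :: real assume "\<epsilon> > 0"
  have g1: "(\<lambda>n. g n $ 1) \<longlonglongrightarrow> e$1" and g2: "(\<lambda>n. g n $ 2) \<longlonglongrightarrow> e$2"
    using g by (auto intro: tendsto_vec_nth)
  have "(\<lambda>n. g n $ 1 / g n $ 2) \<longlonglongrightarrow> e$1 / e$2"
    using g1 g2 \<open>e$2 \<noteq> 0\<close> by (rule tendsto_divide)
  then have "\<forall>\<^sub>F n in sequentially. \<bar>g n $ 1 / g n $ 2 - e$1 / e$2\<bar> < \<epsilon>"
    using \<open>\<epsilon> > 0\<close> by (auto dest: tendstoD simp: dist_real_def)
  moreover have "\<forall>\<^sub>F n in sequentially. g n $ 2 \<noteq> 0"
    using g2 \<open>e$2 \<noteq> 0\<close> by (rule tendsto_imp_eventually_ne)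
  ultimately show "\<forall>\<^sub>F n in sequentially. \<exists>t. f n = Fin t \<and> \<bar>t - e$1 / e$2\<bar> < \<epsilon>"
    using f by eventually_elim (auto simp: proj_of_def)
qed

lemma pconv_Inf_of_tendsto:
  assumes g: "g \<longlonglongrightarrow> e" and "e$2 = 0" "e$1 \<noteq> 0"
    and f: "\<forall>\<^sub>F n in sequentially. f n = proj_of (g n)"
  shows "pconv f Inf"
  unfolding pconv_Inf_iff
proof
  fix K :: real
  have g1: "(\<lambda>n. g n $ 1) \<longlonglongrightarrow> e$1" and g2: "(\<lambda>n. g n $ 2) \<longlonglongrightarrow> e$2"
    using g by (auto intro: tendsto_vec_nth)
  have "(\<lambda>n. g n $ 2 / g n $ 1) \<longlonglongrightarrow> 0"
    using tendsto_divide[OF g2 g1 \<open>e$1 \<noteq> 0\<close>] \<open>e$2 = 0\<close> by simp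
  then have "\<forall>\<^sub>F n in sequentially. \<bar>g n $ 2 / g n $ 1\<bar> < 1 / (\<bar>K\<bar> + 1)"
    by (auto dest!: tendstoD[where e = "1 / (\<bar>K\<bar> + 1)"] simp: dist_real_def)
  moreover have "\<forall>\<^sub>F n in sequentially. g n $ 1 \<noteq> 0"
    using g1 \<open>e$1 \<noteq> 0\<close> by (rule tendsto_imp_eventually_ne)
  ultimately show "\<forall>\<^sub>F n in sequentially. f n = Inf \<or> (\<exists>t. f n = Fin t \<and> \<bar>t\<bar> > K)"
    using f
  proof eventually_elim
    case (elim n)
    show ?case
    proof (cases "g n $ 2 = 0")
      case False
      with elim have "\<bar>K\<bar> + 1 < \<bar>g n $ 1 / g n $ 2\<bar>"
        by (simp add: field_simps)
      with elim False show ?thesis by (simp add: proj_of_def)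
    qed (use elim in \<open>simp add: proj_of_def\<close>)
  qed
qed

lemma pconv_proj_of_tendsto:
  assumes "g \<longlonglongrightarrow> e" and "e \<noteq> 0" and "\<forall>\<^sub>F n in sequentially. f n = proj_of (g n)"
  shows "pconv f (proj_of e)"
proof (cases "e$2 = 0")
  case True
  with assms(2) have "e$1 \<noteq> 0" by (simp add: vec2_eq_iff)
  with True show ?thesis
    using pconv_Inf_of_tendsto[OF assms(1) _ _ assms(3)] by (simp add: proj_of_def)
next
  case False
  then show ?thesis
    using pconv_Fin_of_tendsto[OF assms(1) _ assms(3)] by (simp add: proj_of_def)
qed

section \<open>Attracting fixed points\<close>

lemma add_divide_self_ge_2: "(x::real) > 0 \<Longrightarrow> x + 1/x \<ge> 2"
  and add_divide_self_gt_2: "(x::real) > 0 \<Longrightarrow> x \<noteq> 1 \<Longrightarrow> x + 1/x > 2"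
proof -
  assume x: "x > 0"
  then have "x + 1/x - 2 = (x - 1)\<^sup>2 / x"
    by (simp add: field_simps power2_eq_square)
  moreover have "(x - 1)\<^sup>2 / x \<ge> 0" "x \<noteq> 1 \<Longrightarrow> (x - 1)\<^sup>2 / x > 0"
    using x by simp_all
  ultimately show "x + 1/x \<ge> 2" "x \<noteq> 1 \<Longrightarrow> x + 1/x > 2"
    by linarith+
qed

lemma diff_divide_self_nonneg: "(x::real) \<ge> 1 \<Longrightarrow> x - 1/x \<ge> 0"
  and diff_divide_self_pos: "(x::real) > 1 \<Longrightarrow> x - 1/x > 0"
proof -
  show "x - 1/x \<ge> 0" if "x \<ge> 1"
  proof -
    from that have "1/x \<le> 1" by simp
    with that show ?thesis by linarith
  qed
  show "x - 1/x > 0" if "x > 1"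
  proof -
    from that have "1/x < 1" by simp
    with that show ?thesis by linarith
  qed
qed

lemma trace_mat_1: "trace (mat 1 :: 'a::comm_semiring_1^2^2) = 2"
  by (simp add: trace_2 mat_1_nth)

lemma att_fp_eqI:
  assumes "mob M x = x" and "\<forall>y. mob M y \<noteq> y \<longrightarrow> pconv (\<lambda>n. (mob M ^^ n) y) x"
    and "\<exists>y. mob M y \<noteq> y"
  shows "att_fp M = x"
  unfolding att_fp_def
proof (rule the_equality)
  fix x' assume "mob M x' = x' \<and> (\<forall>y. mob M y \<noteq> y \<longrightarrow> pconv (\<lambda>n. (mob M ^^ n) y) x')"
  with assms(2,3) show "x' = x" using pconv_unique by blast
qed (use assms(1,2) in blast)

lemma SL2Z_fixing_all_points:
  assumes "SL2Z M" and "\<forall>y. mob M y = y"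
  shows "M = mat 1 \<or> trace M = -2"
proof -
  have "mob M Inf = Inf" "mob M (Fin 0) = Fin 0" "mob M (Fin 1) = Fin 1"
    using assms(2) by auto
  then have "M$2$1 = 0" "M$1$2 = 0" "M$1$1 = M$2$2"
    by (auto simp: mob_def Let_def split: if_splits)
  moreover have "M$1$1 * M$2$2 - M$1$2 * M$2$1 = 1"
    using assms(1) by (simp add: SL2Z_def det_2)
  ultimately have "M$2$2 = 1 \<or> M$2$2 = -1" "M$2$1 = 0" "M$1$2 = 0" "M$1$1 = M$2$2"
    by (simp_all add: zmult_eq_1_iff)
  then show ?thesis by (auto simp: mat2_eq_iff mat_1_nth trace_2)
qed

lemma pconv_orbit:
  assumes "det X \<noteq> 0" "u \<noteq> 0" "g \<longlonglongrightarrow> e" "e \<noteq> 0"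
    and "\<forall>\<^sub>F n in sequentially. \<exists>c. c \<noteq> 0 \<and> ((*v) X ^^ n) u = c *\<^sub>R g n"
  shows "pconv (\<lambda>n. (mob_real X ^^ n) (proj_of u)) (proj_of e)"
  using assms(3,4)
proof (rule pconv_proj_of_tendsto)
  show "\<forall>\<^sub>F n in sequentially. (mob_real X ^^ n) (proj_of u) = proj_of (g n)"
    using assms(5) by eventually_elim (auto simp: funpow_mob_real[OF assms(1,2)] proj_of_scaleR)
qed

lemma att_fp_eqI_orbits:
  assumes M: "SL2Z M" "M \<noteq> mat 1" "trace M \<noteq> -2"
    and "mob M (proj_of e) = proj_of e"
    and orbits: "\<And>v. v \<noteq> 0 \<Longrightarrow> mob M (proj_of v) \<noteq> proj_of v \<Longrightarrow>
      \<exists>g p. g \<longlonglongrightarrow> p \<and> p \<noteq> 0 \<and> proj_of p = proj_of e \<and>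
        (\<forall>\<^sub>F n in sequentially. \<exists>c. c \<noteq> 0 \<and> ((*v) (real_mat M) ^^ n) v = c *\<^sub>R g n)"
  shows "att_fp M = proj_of e"
proof (rule att_fp_eqI)
  show "\<exists>y. mob M y \<noteq> y"
    using SL2Z_fixing_all_points M by blast
  show "\<forall>y. mob M y \<noteq> y \<longrightarrow> pconv (\<lambda>n. (mob M ^^ n) y) (proj_of e)"
  proof (intro allI impI)
    fix y assume "mob M y \<noteq> y"
    then obtain g p where "g \<longlonglongrightarrow> p" "p \<noteq> 0" "proj_of p = proj_of e"
      and "\<forall>\<^sub>F n in sequentially. \<exists>c. c \<noteq> 0 \<and> ((*v) (real_mat M) ^^ n) (vec_of_proj y) = c *\<^sub>R g n"
      using orbits[of "vec_of_proj y"] by auto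
    then have "pconv (\<lambda>n. (mob_real (real_mat M) ^^ n) (proj_of (vec_of_proj y))) (proj_of p)"
      by (intro pconv_orbit) (simp_all add: SL2Z_det_real_mat[OF M(1)])
    with \<open>proj_of p = proj_of e\<close> show "pconv (\<lambda>n. (mob M ^^ n) y) (proj_of e)"
      by (simp add: mob_eq_mob_real)
  qed
qed (rule assms(4))

lemma hyperbolic_eigendecomposition:
  fixes X :: "real^2^2"
  assumes "det X = 1" and "trace X = lam + 1/lam" and "lam > 1"
  obtains p q where "v = p + q" "X *v p = lam *\<^sub>R p" "X *v q = (1/lam) *\<^sub>R q"
proof -
  have lam: "lam \<noteq> 0" "lam - 1/lam \<noteq> 0"
    using diff_divide_self_pos[OF assms(3)] assms(3) by auto
  define c where "c = 1 / (lam - 1/lam)"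
  define p where "p = c *\<^sub>R (X *v v - (1/lam) *\<^sub>R v)"
  define q where "q = c *\<^sub>R (lam *\<^sub>R v - X *v v)"
  have "X *v (X *v v) = (lam + 1/lam) *\<^sub>R (X *v v) - v"
    using cayley_hamilton_2[of X v] assms(1,2) by simp
  then have "X *v (X *v v) - (1/lam) *\<^sub>R (X *v v) = lam *\<^sub>R (X *v v - (1/lam) *\<^sub>R v)"
    "lam *\<^sub>R (X *v v) - X *v (X *v v) = (1/lam) *\<^sub>R (lam *\<^sub>R v - X *v v)"
    using lam by (simp_all add: vec2_eq_iff field_simps del: matrix_vector_mult_2)
  then have Xp: "X *v p = lam *\<^sub>R p" and Xq: "X *v q = (1/lam) *\<^sub>R q"
    unfolding p_def q_def
    by (simp_all add: matrix_vector_mult_scaleR matrix_vector_mult_diff_distrib mult.commute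
        del: matrix_vector_mult_2)
  have "p + q = (c * (lam - 1/lam)) *\<^sub>R v"
    by (simp add: p_def q_def algebra_simps del: matrix_vector_mult_2)
  then have "v = p + q"
    using lam by (simp add: c_def)
  with Xp Xq that show ?thesis by blast
qed

lemma hyperbolic_orbit:
  fixes X :: "real^2^2"
  assumes "X *v p = lam *\<^sub>R p" and "X *v q = (1/lam) *\<^sub>R q" and "lam \<noteq> 0"
  shows "((*v) X ^^ n) (p + q) = lam^n *\<^sub>R (p + ((1 / lam\<^sup>2)^n) *\<^sub>R q)"
proof -
  have "((*v) X ^^ n) (p + q) = (lam^n) *\<^sub>R p + ((1/lam)^n) *\<^sub>R q"
    by (induction n) (simp_all add: assms(1,2) algebra_simps del: matrix_vector_mult_2)
  then show ?thesis
    using assms(3) by (simp add: scaleR_add_right power_divide power_mult_distrib power2_eq_square)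
qed

text \<open>In the hyperbolic case \<open>X\<^sup>n v = \<lambda>\<^sup>n (p + \<lambda>\<^sup>-\<^sup>2\<^sup>n q)\<close>, and \<open>p \<noteq> 0\<close> unless \<open>v\<close>
  lies on the repelling eigenline.\<close>

lemma att_fp_hyperbolic:
  assumes M: "SL2Z M" and lam: "lam > 1" and tr: "real_of_int (trace M) = lam + 1/lam"
    and e: "e \<noteq> 0" and ev: "real_mat M *v e = lam *\<^sub>R e"
  shows "att_fp M = proj_of e"
proof (rule att_fp_eqI_orbits[OF M])
  define X where "X = real_mat M"
  have dX: "det X = 1" and trX: "trace X = lam + 1/lam" and mobX: "mob M = mob_real X"
    using M tr by (simp_all add: X_def SL2Z_det_real_mat trace_real_mat mob_eq_mob_real)
  have "lam * lam > 1"
    using lam less_1_mult by blast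
  then have lam0: "lam \<noteq> 0" "lam\<^sup>2 \<noteq> 1" "norm (1 / lam\<^sup>2) < 1"
    using lam by (auto simp: power2_eq_square)
  from lam have "lam + 1/lam > 2" by (simp add: add_divide_self_gt_2)
  with tr show "M \<noteq> mat 1" "trace M \<noteq> -2"
    using trace_mat_1[where 'a = int] by auto
  show "mob M (proj_of e) = proj_of e"
    using e ev lam0 by (simp add: mobX mob_real_proj_of X_def proj_of_scaleR)
  fix v assume v: "v \<noteq> 0" and moved: "mob M (proj_of v) \<noteq> proj_of v"
  obtain p q where v_eq: "v = p + q" and Xp: "X *v p = lam *\<^sub>R p" and Xq: "X *v q = (1/lam) *\<^sub>R q"
    using hyperbolic_eigendecomposition[OF dX trX lam] .
  note orbit = hyperbolic_orbit[OF Xp Xq lam0(1), folded v_eq]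
  have p: "p \<noteq> 0"
  proof
    assume "p = 0"
    then have "X *v v = (1/lam) *\<^sub>R v" using v_eq Xq by simp
    with moved v lam0 show False by (simp add: mobX mob_real_proj_of proj_of_scaleR)
  qed
  have "cross2 p e = lam\<^sup>2 * cross2 p e"
    using cross2_matrix_vector_mult[of X p e] dX Xp ev
    by (simp add: X_def power2_eq_square del: matrix_vector_mult_2)
  then have "proj_of p = proj_of e"
    using p e lam0 by (simp add: proj_of_eq_iff)
  moreover have "(\<lambda>n. p + ((1 / lam\<^sup>2)^n) *\<^sub>R q) \<longlonglongrightarrow> p"
    using tendsto_add[OF tendsto_const tendsto_scaleR[OF LIMSEQ_power_zero[OF lam0(3)] tendsto_const]]
    by simp
  moreover have "\<forall>\<^sub>F n in sequentially. \<exists>c. c \<noteq> 0 \<and> ((*v) X ^^ n) v = c *\<^sub>R (p + ((1 / lam\<^sup>2)^n) *\<^sub>R q)"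
  proof (intro always_eventually allI)
    fix n
    show "\<exists>c. c \<noteq> 0 \<and> ((*v) X ^^ n) v = c *\<^sub>R (p + ((1 / lam\<^sup>2)^n) *\<^sub>R q)"
      using orbit[of n] lam0 by (intro exI[of _ "lam^n"]) simp
  qed
  ultimately show "\<exists>g p. g \<longlonglongrightarrow> p \<and> p \<noteq> 0 \<and> proj_of p = proj_of e \<and>
      (\<forall>\<^sub>F n in sequentially. \<exists>c. c \<noteq> 0 \<and> ((*v) (real_mat M) ^^ n) v = c *\<^sub>R g n)"
    using p unfolding X_def by blast
qed

lemma fixing_independent_vectors_imp_identity:
  assumes "X *v w = w" "X *v e = e" "cross2 w e \<noteq> 0"
  shows "X = mat 1"
proof -
  have "X *v u = u" for u
  proof -
    let ?a = "cross2 u e / cross2 w e" and ?b = "cross2 w u / cross2 w e"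
    have u: "u = ?a *\<^sub>R w + ?b *\<^sub>R e"
      by (rule cross2_coordinates[OF assms(3)])
    have "X *v (?a *\<^sub>R w + ?b *\<^sub>R e) = ?a *\<^sub>R w + ?b *\<^sub>R e"
      using assms(1,2)
      by (simp add: matrix_vector_right_distrib matrix_vector_mult_scaleR del: matrix_vector_mult_2)
    from this[folded u] show ?thesis .
  qed
  then show ?thesis by (simp add: matrix_eq)
qed

lemma parabolic_orbit:
  fixes X :: "real^2^2"
  assumes "det X = 1" and "trace X = 2" and w: "w = X *v v - v"
  shows "X *v w = w" and "((*v) X ^^ n) v = v + real n *\<^sub>R w"
proof -
  have "X *v (X *v v) = 2 *\<^sub>R (X *v v) - v"
    using cayley_hamilton_2[of X v] assms(1,2) by simp
  then show Xw: "X *v w = w"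
    unfolding w by (simp add: vec2_eq_iff algebra_simps del: matrix_vector_mult_2)
  have Xv: "X *v v = v + w" by (simp add: w)
  show "((*v) X ^^ n) v = v + real n *\<^sub>R w"
    by (induction n) (simp_all add: Xv Xw algebra_simps del: matrix_vector_mult_2)
qed

lemma att_fp_parabolic:
  assumes M: "SL2Z M" and tr: "trace M = 2" and M1: "M \<noteq> mat 1"
    and e: "e \<noteq> 0" and ev: "real_mat M *v e = e"
  shows "att_fp M = proj_of e"
proof (rule att_fp_eqI_orbits[OF M M1])
  define X where "X = real_mat M"
  have dX: "det X = 1" and trX: "trace X = 2" and mobX: "mob M = mob_real X"
    using M tr by (simp_all add: X_def SL2Z_det_real_mat trace_real_mat mob_eq_mob_real)
  show "trace M \<noteq> -2" "mob M (proj_of e) = proj_of e"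
    using tr e ev by (simp_all add: mobX mob_real_proj_of X_def)
  fix v assume v: "v \<noteq> 0" and moved: "mob M (proj_of v) \<noteq> proj_of v"
  define w where "w = X *v v - v"
  have Xw: "X *v w = w" and orbit: "((*v) X ^^ n) v = v + real n *\<^sub>R w" for n
    using parabolic_orbit[OF dX trX w_def] by simp_all
  have w: "w \<noteq> 0"
    using moved v by (auto simp: mobX mob_real_proj_of w_def)
  have "cross2 w e = 0"
    using fixing_independent_vectors_imp_identity[OF Xw] ev M1
    by (auto simp: X_def real_mat_eq_1_iff)
  then have "proj_of w = proj_of e"
    using w e by (simp add: proj_of_eq_iff)
  moreover have "(\<lambda>n. inverse (real n) *\<^sub>R v + w) \<longlonglongrightarrow> w"
    using tendsto_add[OF tendsto_scaleR[OF lim_inverse_n tendsto_const] tendsto_const] by simp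
  moreover have "\<forall>\<^sub>F n in sequentially. \<exists>c. c \<noteq> 0 \<and> ((*v) X ^^ n) v = c *\<^sub>R (inverse (real n) *\<^sub>R v + w)"
  proof (rule eventually_mono[OF eventually_gt_at_top[of 0]])
    fix n :: nat assume "n > 0"
    then show "\<exists>c. c \<noteq> 0 \<and> ((*v) X ^^ n) v = c *\<^sub>R (inverse (real n) *\<^sub>R v + w)"
      by (intro exI[of _ "real n"]) (simp add: orbit scaleR_add_right)
  qed
  ultimately show "\<exists>g p. g \<longlonglongrightarrow> p \<and> p \<noteq> 0 \<and> proj_of p = proj_of e \<and>
      (\<forall>\<^sub>F n in sequentially. \<exists>c. c \<noteq> 0 \<and> ((*v) (real_mat M) ^^ n) v = c *\<^sub>R g n)"
    using w unfolding X_def by blast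
qed

lemma att_fp_eigenvector:
  assumes "SL2Z M" and "M \<noteq> mat 1" and "lam \<ge> 1" and "real_of_int (trace M) = lam + 1/lam"
    and "e \<noteq> 0" and "real_mat M *v e = lam *\<^sub>R e"
  shows "att_fp M = proj_of e"
proof (cases "lam = 1")
  case True
  with assms show ?thesis by (intro att_fp_parabolic) simp_all
next
  case False
  with assms show ?thesis by (intro att_fp_hyperbolic) simp_all
qed

lemma rep_fp_eigenvector:
  assumes M: "SL2Z M" and "M \<noteq> mat 1" and "lam \<ge> 1" and "real_of_int (trace M) = lam + 1/lam"
    and "e \<noteq> 0" and "real_mat M *v e = (1/lam) *\<^sub>R e"
  shows "rep_fp M = proj_of e"
  unfolding rep_fp_def
proof (rule att_fp_eigenvector)
  show "real_mat (inv2 M) *v e = lam *\<^sub>R e"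
    using real_mat_inv2_eigenvector[OF M assms(6)] assms(3) by simp
qed (use assms in \<open>simp_all add: SL2Z_inv2 inv2_eq_1_iff trace_inv2\<close>)

lemma obtain_add_divide_self_eq:
  assumes "(t::real) \<ge> 2"
  obtains lam where "lam \<ge> 1" "t = lam + 1/lam" "t > 2 \<Longrightarrow> lam > 1"
proof
  define s where "s = sqrt (t * t - 4)"
  have "t * t \<ge> 2 * 2" using mult_mono[of 2 t 2 t] assms by simp
  then have s: "s \<ge> 0" "s * s = t * t - 4" by (simp_all add: s_def)
  show "(t + s) / 2 \<ge> 1" using assms s by simp
  then show "t = (t + s) / 2 + 1 / ((t + s) / 2)"
    using s by (simp add: field_simps)
  show "t > 2 \<Longrightarrow> (t + s) / 2 > 1" using s by simp
qed

lemma eigenvector_exists: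
  assumes d: "det (X::real^2^2) = 1" and t: "trace X = lam + 1/lam" and "lam \<ge> 1"
    and "X \<noteq> mat 1"
  obtains v where "v \<noteq> 0" "X *v v = (1/lam) *\<^sub>R v"
proof -
  have "lam \<noteq> 0" using \<open>lam \<ge> 1\<close> by simp
  have image_is_eigenvector: "X *v (X *v u - lam *\<^sub>R u) = (1/lam) *\<^sub>R (X *v u - lam *\<^sub>R u)" for u
  proof -
    have "X *v (X *v u) = (lam + 1/lam) *\<^sub>R (X *v u) - u"
      using cayley_hamilton_2[of X u] d t by simp
    then show ?thesis
      using \<open>lam \<noteq> 0\<close>
      by (simp add: vec2_eq_iff matrix_vector_mult_diff_distrib matrix_vector_mult_scaleR field_simps
          del: matrix_vector_mult_2)
  qed
  show ?thesis
  proof (cases "\<forall>u. X *v u - lam *\<^sub>R u = 0")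
    case True
    then have X: "X *v u = lam *\<^sub>R u" for u by simp
    have "lam * lam = 1"
      using cross2_matrix_vector_mult[of X "vector [1, 0]" "vector [0, 1]"] d
      by (simp add: X cross2_def)
    with \<open>lam \<ge> 1\<close> have "lam = 1"
      by (metis less_1_mult order_le_less less_irrefl)
    with X have "X = mat 1" by (simp add: matrix_eq)
    with \<open>X \<noteq> mat 1\<close> show ?thesis ..
  next
    case False
    then show ?thesis using image_is_eigenvector that by blast
  qed
qed

section \<open>Arcs as projectivised cones\<close>

lemma ccw_int_iff_cross2:
  "z \<in> ccw_int p q \<longleftrightarrow> z = p \<or> z = q \<or>
     cross2 (vec_of_proj p) (vec_of_proj z) * cross2 (vec_of_proj z) (vec_of_proj q) *
     cross2 (vec_of_proj q) (vec_of_proj p) > 0"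
proof (cases p; cases q; cases z)
  fix x y t assume h: "p = Fin x" "q = Fin y" "z = Fin t"
  then have "cross2 (vec_of_proj p) (vec_of_proj z) * cross2 (vec_of_proj z) (vec_of_proj q) *
      cross2 (vec_of_proj q) (vec_of_proj p) = (x - t) * (t - y) * (y - x)"
    by (simp add: cross2_def vec_of_proj_def)
  with h show ?thesis
    by (cases "x \<le> y") (auto simp: zero_less_mult_iff mult_less_0_iff)
qed (auto simp: cross2_def vec_of_proj_def)

definition cone2 :: "real^2 \<Rightarrow> real^2 \<Rightarrow> (real^2) set" where
  "cone2 P Q = {s *\<^sub>R P + t *\<^sub>R Q | s t. s \<ge> 0 \<and> t \<ge> 0 \<and> s + t > 0}"

lemma cone2_commute: "cone2 P Q = cone2 Q P"
  unfolding cone2_def by (auto simp: add.commute) (metis add.commute)+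

lemma left_in_cone2: "P \<in> cone2 P Q"
  unfolding cone2_def by (rule CollectI, rule exI[of _ 1], rule exI[of _ 0]) simp

lemma right_in_cone2: "Q \<in> cone2 P Q"
  using left_in_cone2 cone2_commute by metis

lemma cone2_nonzero:
  assumes "cross2 P Q \<noteq> 0" and "w \<in> cone2 P Q"
  shows "w \<noteq> 0"
proof -
  obtain s t where st: "s \<ge> 0" "t \<ge> 0" "s + t > 0" and w: "w = s *\<^sub>R P + t *\<^sub>R Q"
    using assms(2) by (auto simp: cone2_def)
  have "cross2 w Q = s * cross2 P Q" "cross2 P w = t * cross2 P Q"
    by (simp_all add: w)
  with st assms(1) show "w \<noteq> 0" by auto
qed

lemma cross2_sign_in_cone2:
  assumes "w \<in> cone2 P Q"
  shows "cross2 w Q * cross2 P w \<ge> 0"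
proof -
  obtain s t where st: "s \<ge> 0" "t \<ge> 0" and w: "w = s *\<^sub>R P + t *\<^sub>R Q"
    using assms by (auto simp: cone2_def)
  then have "cross2 w Q * cross2 P w = (s * t) * (cross2 P Q)\<^sup>2"
    by (simp add: power2_eq_square algebra_simps)
  with st show ?thesis by simp
qed

lemma proj_of_in_cone2_iff:
  assumes D: "cross2 P Q \<noteq> 0" and u: "u \<noteq> 0"
  shows "proj_of u \<in> proj_of ` cone2 P Q \<longleftrightarrow> cross2 u Q * cross2 P u \<ge> 0"
proof
  assume "proj_of u \<in> proj_of ` cone2 P Q"
  then obtain w where w: "w \<in> cone2 P Q" and "proj_of u = proj_of w" by auto
  then have "cross2 u w = 0"
    using u cone2_nonzero[OF D w] by (simp add: proj_of_eq_iff)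
  then obtain k where k: "w = k *\<^sub>R u"
    using cross2_eq_0_imp_parallel[OF u] by blast
  with cross2_sign_in_cone2[OF w] have "k\<^sup>2 * (cross2 u Q * cross2 P u) \<ge> 0"
    by (simp add: power2_eq_square algebra_simps)
  moreover have "k \<noteq> 0" using k cone2_nonzero[OF D w] by auto
  ultimately show "cross2 u Q * cross2 P u \<ge> 0" by (simp add: zero_le_mult_iff)
next
  assume h: "cross2 u Q * cross2 P u \<ge> 0"
  define s where "s = cross2 u Q / cross2 P Q"
  define t where "t = cross2 P u / cross2 P Q"
  have u_eq: "u = s *\<^sub>R P + t *\<^sub>R Q"
    using cross2_coordinates[OF D] by (simp add: s_def t_def)
  have "s * t \<ge> 0"
    using h by (simp add: s_def t_def)
  moreover have "\<not> (s = 0 \<and> t = 0)" using u u_eq by auto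
  ultimately consider "s \<ge> 0" "t \<ge> 0" "s + t > 0" | "-s \<ge> 0" "-t \<ge> 0" "-s + -t > 0"
    by (auto simp: zero_le_mult_iff)
  then show "proj_of u \<in> proj_of ` cone2 P Q"
  proof cases
    case 1
    then have "u \<in> cone2 P Q" unfolding cone2_def u_eq by blast
    then show ?thesis by blast
  next
    case 2
    then have "- u \<in> cone2 P Q" unfolding cone2_def u_eq
      by (intro CollectI exI[of _ "-s"] exI[of _ "-t"]) (simp add: algebra_simps)
    then show ?thesis using proj_of_uminus by (metis image_eqI)
  qed
qed

lemma ccw_int_eq_cone2:
  assumes D: "cross2 P Q < 0"
  shows "ccw_int (proj_of P) (proj_of Q) = proj_of ` cone2 P Q"
proof (rule set_eqI)
  fix z
  define u where "u = vec_of_proj z"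
  have z: "z = proj_of u" and u: "u \<noteq> 0" by (simp_all add: u_def)
  have P: "P \<noteq> 0" and Q: "Q \<noteq> 0"
    using D cross2_nonzero_imp_nonzero[of P Q] by auto
  obtain a where a: "a \<noteq> 0" "vec_of_proj (proj_of P) = a *\<^sub>R P" using vec_of_proj_of[OF P] .
  obtain b where b: "b \<noteq> 0" "vec_of_proj (proj_of Q) = b *\<^sub>R Q" using vec_of_proj_of[OF Q] .
  define k where "k = (a * b)\<^sup>2 * (- cross2 P Q)"
  have "(a * b)\<^sup>2 > 0" using a b by simp
  then have k: "k > 0" unfolding k_def using D by (intro mult_pos_pos) simp_all
  have "z \<in> ccw_int (proj_of P) (proj_of Q) \<longleftrightarrow>
      cross2 P u = 0 \<or> cross2 u Q = 0 \<or> k * (cross2 u Q * cross2 P u) > 0"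
  proof -
    have "z = proj_of P \<longleftrightarrow> cross2 P u = 0" "z = proj_of Q \<longleftrightarrow> cross2 u Q = 0"
      using z u P Q proj_of_eq_iff cross2_commute[of u P] by auto
    moreover have "cross2 (vec_of_proj (proj_of P)) u * cross2 u (vec_of_proj (proj_of Q)) *
        cross2 (vec_of_proj (proj_of Q)) (vec_of_proj (proj_of P)) = k * (cross2 u Q * cross2 P u)"
      by (simp add: k_def a b cross2_commute[of Q P] power2_eq_square algebra_simps)
    ultimately show ?thesis
      using ccw_int_iff_cross2[of z "proj_of P" "proj_of Q"] by (simp add: u_def)
  qed
  also have "\<dots> \<longleftrightarrow> cross2 u Q * cross2 P u \<ge> 0"
  proof -
    have "k * x > 0 \<longleftrightarrow> x > 0" for x
      using k zero_less_mult_pos mult_pos_pos by blast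
    then show ?thesis by (auto simp: order_le_less)
  qed
  also have "\<dots> \<longleftrightarrow> z \<in> proj_of ` cone2 P Q"
    using proj_of_in_cone2_iff[OF _ u] D z by simp
  finally show "z \<in> ccw_int (proj_of P) (proj_of Q) \<longleftrightarrow> z \<in> proj_of ` cone2 P Q" .
qed

lemma ccw_int_cases:
  assumes "cross2 P Q \<noteq> 0"
  shows "ccw_int (proj_of P) (proj_of Q) = proj_of ` cone2 P Q \<and>
           ccw_int (proj_of Q) (proj_of P) = proj_of ` cone2 (-P) Q \<or>
         ccw_int (proj_of P) (proj_of Q) = proj_of ` cone2 (-P) Q \<and>
           ccw_int (proj_of Q) (proj_of P) = proj_of ` cone2 P Q"
proof (cases "cross2 P Q < 0")
  case True
  then have "ccw_int (proj_of Q) (proj_of (-P)) = proj_of ` cone2 Q (-P)"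
    by (intro ccw_int_eq_cone2) (simp add: cross2_commute[of Q P])
  then show ?thesis
    using ccw_int_eq_cone2[OF True] by (simp add: proj_of_uminus cone2_commute)
next
  case False
  with assms have "cross2 (-P) Q < 0" "cross2 Q P < 0"
    by (simp_all add: cross2_commute[of Q P])
  then show ?thesis
    using ccw_int_eq_cone2 by (metis proj_of_uminus cone2_commute)
qed

lemma cone2_invariant:
  assumes D: "cross2 P Q \<noteq> 0" and "det X \<noteq> 0"
    and XP: "X *v P = a *\<^sub>R P + b *\<^sub>R Q" and XQ: "X *v Q = c *\<^sub>R P + d *\<^sub>R Q"
    and "a \<ge> 0" "b \<ge> 0" "c \<ge> 0" "d \<ge> 0"
  shows "mob_real X ` (proj_of ` cone2 P Q) \<subseteq> proj_of ` cone2 P Q"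
proof clarify
  fix w assume w: "w \<in> cone2 P Q"
  then obtain s t where st: "s \<ge> 0" "t \<ge> 0" "s + t > 0" and w_eq: "w = s *\<^sub>R P + t *\<^sub>R Q"
    by (auto simp: cone2_def)
  have Xw: "X *v w = (s*a + t*c) *\<^sub>R P + (s*b + t*d) *\<^sub>R Q"
    by (simp add: w_eq XP XQ algebra_simps del: matrix_vector_mult_2)
  have "X *v w \<noteq> 0"
    using cone2_nonzero[OF D w] \<open>det X \<noteq> 0\<close> matrix_vector_mult_eq_0_iff by blast
  then have "\<not> (s*a + t*c = 0 \<and> s*b + t*d = 0)" using Xw by auto
  moreover have nonneg: "s*a + t*c \<ge> 0" "s*b + t*d \<ge> 0"
    using st assms(5-8) by simp_all
  ultimately have "s*a + t*c + (s*b + t*d) > 0"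
    by (metis add_nonneg_eq_0_iff add_nonneg_nonneg order_less_le)
  then have "X *v w \<in> cone2 P Q"
    unfolding cone2_def using Xw nonneg by blast
  then show "mob_real X (proj_of w) \<in> proj_of ` cone2 P Q"
    by (simp add: mob_real_proj_of[OF cone2_nonzero[OF D w]])
qed

lemma cone2_not_invariant:
  assumes D: "cross2 P Q \<noteq> 0" and w: "w \<in> cone2 P Q"
    and Xw: "X *v w = s *\<^sub>R P + t *\<^sub>R Q" and "s * t < 0"
  shows "\<not> mob_real X ` (proj_of ` cone2 P Q) \<subseteq> proj_of ` cone2 P Q"
proof
  assume invariant: "mob_real X ` (proj_of ` cone2 P Q) \<subseteq> proj_of ` cone2 P Q"
  have "cross2 (X *v w) Q = s * cross2 P Q" "cross2 P (X *v w) = t * cross2 P Q"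
    by (simp_all add: Xw)
  moreover have "X *v w \<noteq> 0"
    using calculation D \<open>s * t < 0\<close> by auto
  moreover have "proj_of (X *v w) \<in> proj_of ` cone2 P Q"
    using invariant w by (auto simp: mob_real_proj_of[OF cone2_nonzero[OF D w], symmetric])
  ultimately have "(s * t) * (cross2 P Q)\<^sup>2 \<ge> 0"
    using proj_of_in_cone2_iff[OF D] by (simp add: power2_eq_square algebra_simps)
  moreover have "(cross2 P Q)\<^sup>2 > 0" using D by simp
  ultimately show False
    using \<open>s * t < 0\<close> by (metis mult_neg_pos not_le)
qed

section \<open>Integrality\<close>

lemma rational_root_imp_trace_pm2:
  assumes "(d::real) \<in> \<rat>" and eq: "d * d - of_int t * d + 1 = 0"
  shows "t = 2 \<or> t = -2"
proof -
  obtain a b where b: "b > 0" and "coprime a b" and d: "d = of_int a / of_int b"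
    using Rats_cases'[OF assms(1)] by blast
  have "real_of_int (a*a - t*a*b + b*b) = (real_of_int b)\<^sup>2 * (d * d - of_int t * d + 1)"
    using b by (simp add: d field_simps power2_eq_square)
  also have "\<dots> = 0" using eq by simp
  finally have ab: "a*a - t*a*b + b*b = 0" by (simp only: of_int_eq_0_iff)
  then have "a * a = b * (t * a - b)" by (simp add: algebra_simps)
  then have "b dvd a * a" by simp
  with \<open>coprime a b\<close> have "is_unit b"
    by (meson coprime_common_divisor coprime_mult_left_iff dvd_refl)
  with b have "b = 1" by simp
  with ab have "a * (t - a) = 1" by (simp add: algebra_simps)
  then show ?thesis by (auto simp: zmult_eq_1_iff)
qed

lemma integer_kernel_rational_direction:
  assumes "N \<noteq> 0" and "real_mat N *v v = 0"
  obtains w where "w \<noteq> 0" "w$1 \<in> \<rat>" "w$2 \<in> \<rat>" "cross2 w v = 0"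
proof -
  obtain i where i: "N$i$1 \<noteq> 0 \<or> N$i$2 \<noteq> 0"
    using assms(1) by (metis vec2_eq_iff zero_index)
  define w :: "real^2" where "w = vector [- real_of_int (N$i$2), real_of_int (N$i$1)]"
  have "(real_mat N *v v)$i = 0" using assms(2) by simp
  then have "cross2 w v = 0" by (simp add: w_def cross2_def algebra_simps)
  moreover have "w \<noteq> 0" using i by (auto simp: w_def vec2_eq_iff)
  ultimately show ?thesis using that by (simp add: w_def)
qed

lemma rational_eigenvalue:
  assumes "real_mat B *v w = d *\<^sub>R w" and "w \<noteq> 0" and "w$1 \<in> \<rat>" "w$2 \<in> \<rat>"
  shows "d \<in> \<rat>"
proof -
  obtain j where "w$j \<noteq> 0" using assms(2) by (auto simp: vec2_eq_iff)
  then have "d = (real_mat B *v w)$j / w$j" using assms(1) by simp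
  moreover have "w$j \<in> \<rat>" using assms(3,4) exhaust_2[of j] by auto
  moreover have "(real_mat B *v w)$j \<in> \<rat>" using assms(3,4) by simp
  ultimately show ?thesis by simp
qed

text \<open>A common eigenvector lies in the kernel of the integer matrix \<open>A B - B A\<close>, so its
  direction is rational; its \<open>B\<close>-eigenvalue is then a rational root of \<open>x\<^sup>2 - tr(B) x + 1\<close>.\<close>

lemma no_common_eigenvector:
  assumes B: "SL2Z B" and "trace B \<noteq> 2" "trace B \<noteq> -2" and "A ** B \<noteq> B ** A"
    and Av: "real_mat A *v v = c *\<^sub>R v" and Bv: "real_mat B *v v = d *\<^sub>R v"
  shows "v = 0"
proof (rule ccontr)
  assume "v \<noteq> 0"
  have "real_mat (A ** B - B ** A) *v v = real_mat A *v (real_mat B *v v) - real_mat B *v (real_mat A *v v)"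
    by (simp add: vec2_eq_iff algebra_simps)
  then have "real_mat (A ** B - B ** A) *v v = 0"
    by (simp add: Av Bv matrix_vector_mult_scaleR del: matrix_vector_mult_2)
  moreover have "A ** B - B ** A \<noteq> 0" using assms(4) by simp
  ultimately obtain w where w: "w \<noteq> 0" "w$1 \<in> \<rat>" "w$2 \<in> \<rat>" and "cross2 w v = 0"
    using integer_kernel_rational_direction by blast
  then obtain k where "v = k *\<^sub>R w" using cross2_eq_0_imp_parallel by blast
  with \<open>v \<noteq> 0\<close> Bv have "k *\<^sub>R (real_mat B *v w) = k *\<^sub>R (d *\<^sub>R w)" "k \<noteq> 0"
    by (simp_all add: matrix_vector_mult_scaleR del: matrix_vector_mult_2)
  then have Bw: "real_mat B *v w = d *\<^sub>R w"
    by (simp del: matrix_vector_mult_2 scaleR_scaleR)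
  have "(d * d) *\<^sub>R w = (real_of_int (trace B) * d - 1) *\<^sub>R w"
    using cayley_hamilton_2[of "real_mat B" w] B
    by (simp add: Bw trace_real_mat SL2Z_det_real_mat algebra_simps del: matrix_vector_mult_2)
  then have "d * d - of_int (trace B) * d + 1 = 0"
    using w by simp
  with rational_eigenvalue[OF Bw w] show False
    using rational_root_imp_trace_pm2 assms(2,3) by blast
qed

section \<open>The eigenframe of a pair\<close>

text \<open>\<open>a_rep\<close> and \<open>b_rep\<close> span the repelling eigenlines \<open>\<alpha>\<^sup>-\<close> and \<open>\<beta>\<^sup>-\<close>, and
  \<open>a_att\<close> and \<open>b_att\<close> below the attracting ones \<open>\<alpha>\<^sup>+\<close> and \<open>\<beta>\<^sup>+\<close>; in the basis
  \<open>(b_rep, a_rep)\<close> the latter are the directions \<open>(al, 1)\<close> and \<open>(be, 1)\<close>.\<close>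

locale eigenframe =
  fixes A B :: "int^2^2" and lam mu r q :: real and a_rep b_rep :: "real^2"
  assumes SL2Z_A: "SL2Z A" and SL2Z_B: "SL2Z B" and noncommuting: "A ** B \<noteq> B ** A"
    and lam: "lam \<ge> 1" and trace_A: "real_of_int (trace A) = lam + 1/lam"
    and mu: "mu > 1" and trace_B: "real_of_int (trace B) = mu + 1/mu"
    and independent: "cross2 b_rep a_rep \<noteq> 0"
    and A_a_rep: "real_mat A *v a_rep = (1/lam) *\<^sub>R a_rep"
    and A_b_rep: "real_mat A *v b_rep = lam *\<^sub>R b_rep + r *\<^sub>R a_rep"
    and B_b_rep: "real_mat B *v b_rep = (1/mu) *\<^sub>R b_rep"
    and B_a_rep: "real_mat B *v a_rep = mu *\<^sub>R a_rep + q *\<^sub>R b_rep"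
    and r_pos: "r > 0" and q_nonzero: "q \<noteq> 0"
begin

definition al :: real where "al = (lam - 1/lam) / r"
definition be :: real where "be = q / (mu - 1/mu)"
definition a_att :: "real^2" where "a_att = al *\<^sub>R b_rep + a_rep"
definition b_att :: "real^2" where "b_att = be *\<^sub>R b_rep + a_rep"

lemma lam_pos: "lam > 0" and mu_pos: "mu > 0" and mu_minus_inverse_pos: "mu - 1/mu > 0"
  using lam mu diff_divide_self_pos[OF mu] by simp_all

lemma r_al: "r * al = lam - 1/lam"
  using r_pos by (simp add: al_def)

lemma q_be: "q = be * (mu - 1/mu)"
  using mu_minus_inverse_pos by (simp add: be_def)

lemma sgn_be: "be > 0 \<longleftrightarrow> q > 0"
  using mu_minus_inverse_pos by (simp add: be_def zero_less_divide_iff)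

lemma frame_eq_iff: "u = w \<longleftrightarrow> cross2 u a_rep = cross2 w a_rep \<and> cross2 b_rep u = cross2 b_rep w"
proof
  assume "cross2 u a_rep = cross2 w a_rep \<and> cross2 b_rep u = cross2 b_rep w"
  then show "u = w" by (metis cross2_coordinates[OF independent])
qed simp

lemma B_a_rep': "real_mat B *v a_rep = mu *\<^sub>R a_rep + (be * (mu - 1/mu)) *\<^sub>R b_rep"
  using B_a_rep q_be by simp

lemma inv2_A_a_rep: "real_mat (inv2 A) *v a_rep = lam *\<^sub>R a_rep"
  using real_mat_inv2_eigenvector[OF SL2Z_A A_a_rep] lam_pos by simp

lemma inv2_B_b_rep: "real_mat (inv2 B) *v b_rep = mu *\<^sub>R b_rep"
  using real_mat_inv2_eigenvector[OF SL2Z_B B_b_rep] mu_pos by simp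

lemma inv2_A_b_rep: "real_mat (inv2 A) *v b_rep = (1/lam) *\<^sub>R b_rep - r *\<^sub>R a_rep"
  by (rule real_mat_inv2_eqI[OF SL2Z_A])
    (use lam_pos in \<open>simp add: A_a_rep A_b_rep algebra_simps
      del: matrix_vector_mult_2\<close>)

lemma inv2_B_a_rep: "real_mat (inv2 B) *v a_rep = (1/mu) *\<^sub>R a_rep - (be * (mu - 1/mu)) *\<^sub>R b_rep"
  by (rule real_mat_inv2_eqI[OF SL2Z_B])
    (use mu_pos in \<open>simp add: B_a_rep' B_b_rep algebra_simps
      del: matrix_vector_mult_2\<close>)

lemmas frame_simps = a_att_def b_att_def cross2_commute[of a_rep b_rep]
  matrix_vector_right_distrib matrix_vector_mult_diff_distrib matrix_vector_mult_scaleR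
  A_a_rep A_b_rep B_a_rep' B_b_rep inv2_A_a_rep inv2_A_b_rep inv2_B_a_rep inv2_B_b_rep

lemma A_a_att: "real_mat A *v a_att = lam *\<^sub>R a_att"
  unfolding frame_eq_iff using lam_pos mu_pos r_pos
  by (simp add: frame_simps del: matrix_vector_mult_2; simp add: al_def field_simps)

lemma A_b_att: "real_mat A *v b_att = (r * be) *\<^sub>R a_att + (1/lam) *\<^sub>R b_att"
  unfolding frame_eq_iff using lam_pos mu_pos r_pos
  by (simp add: frame_simps del: matrix_vector_mult_2; simp add: al_def field_simps)

lemma A_b_rep_att: "real_mat A *v b_rep = r *\<^sub>R a_att + (1/lam) *\<^sub>R b_rep"
  unfolding frame_eq_iff using lam_pos mu_pos r_pos
  by (simp add: frame_simps del: matrix_vector_mult_2; simp add: al_def field_simps)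

lemma inv2_A_b_att: "real_mat (inv2 A) *v b_att = (r * (al - be)) *\<^sub>R a_rep + (1/lam) *\<^sub>R b_att"
  unfolding frame_eq_iff using lam_pos mu_pos r_pos
  by (simp add: frame_simps del: matrix_vector_mult_2; simp add: al_def field_simps)

lemma B_b_att: "real_mat B *v b_att = mu *\<^sub>R b_att"
  unfolding frame_eq_iff using lam_pos mu_pos r_pos
  by (simp add: frame_simps del: matrix_vector_mult_2; simp add: al_def field_simps)

lemma B_a_att: "real_mat B *v a_att = (1/mu) *\<^sub>R a_att + (mu - 1/mu) *\<^sub>R b_att"
  unfolding frame_eq_iff using lam_pos mu_pos r_pos
  by (simp add: frame_simps del: matrix_vector_mult_2; simp add: al_def field_simps)

lemma B_a_rep_att: "real_mat B *v a_rep = (1/mu) *\<^sub>R a_rep + (mu - 1/mu) *\<^sub>R b_att"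
  unfolding frame_eq_iff using lam_pos mu_pos r_pos
  by (simp add: frame_simps del: matrix_vector_mult_2; simp add: al_def field_simps)

lemma inv2_B_a_att: "real_mat (inv2 B) *v a_att = (1/mu) *\<^sub>R a_att + ((mu - 1/mu) * (al - be)) *\<^sub>R b_rep"
  unfolding frame_eq_iff using lam_pos mu_pos r_pos
  by (simp add: frame_simps del: matrix_vector_mult_2; simp add: al_def field_simps)

lemma A_ne_1: "A \<noteq> mat 1" and B_ne_1: "B \<noteq> mat 1"
  using noncommuting by auto

lemma trace_B_ne_pm2: "trace B \<noteq> 2" "trace B \<noteq> -2"
  using trace_B add_divide_self_gt_2[of mu] mu by auto

lemma a_rep_nonzero: "a_rep \<noteq> 0" and b_rep_nonzero: "b_rep \<noteq> 0"
  using cross2_nonzero_imp_nonzero[OF independent] by simp_all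

lemma a_att_nonzero: "a_att \<noteq> 0" and b_att_nonzero: "b_att \<noteq> 0"
proof -
  have "cross2 b_rep a_att \<noteq> 0" "cross2 b_rep b_att \<noteq> 0"
    using independent by (simp_all add: a_att_def b_att_def)
  then show "a_att \<noteq> 0" "b_att \<noteq> 0" using cross2_nonzero_imp_nonzero by blast+
qed

lemma att_fp_A: "att_fp A = proj_of a_att"
  by (rule att_fp_eigenvector[OF SL2Z_A A_ne_1 lam trace_A a_att_nonzero A_a_att])

lemma rep_fp_A: "rep_fp A = proj_of a_rep"
  by (rule rep_fp_eigenvector[OF SL2Z_A A_ne_1 lam trace_A a_rep_nonzero A_a_rep])

lemma att_fp_B: "att_fp B = proj_of b_att"
  using att_fp_eigenvector[OF SL2Z_B B_ne_1 _ trace_B b_att_nonzero B_b_att] mu by simp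

lemma rep_fp_B: "rep_fp B = proj_of b_rep"
  using rep_fp_eigenvector[OF SL2Z_B B_ne_1 _ trace_B b_rep_nonzero B_b_rep] mu by simp

lemma det_nonzero: "det (real_mat A) \<noteq> 0" "det (real_mat B) \<noteq> 0"
  "det (real_mat (inv2 A)) \<noteq> 0" "det (real_mat (inv2 B)) \<noteq> 0"
  using SL2Z_A SL2Z_B by (simp_all add: SL2Z_det_real_mat SL2Z_inv2)

lemma al_ne_be: "al \<noteq> be"
proof
  assume "al = be"
  then have "real_mat B *v a_att = mu *\<^sub>R a_att"
    using B_b_att by (simp add: a_att_def b_att_def)
  then show False
    using no_common_eigenvector[OF SL2Z_B trace_B_ne_pm2 noncommuting A_a_att] a_att_nonzero
    by blast
qed

lemma cross2_a_att_b_att: "cross2 a_att b_att = (al - be) * cross2 b_rep a_rep"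
  by (simp add: a_att_def b_att_def cross2_commute[of a_rep b_rep] algebra_simps)

text \<open>If \<open>q < 0\<close>, then \<open>A\<close> moves \<open>\<beta>\<^sup>+\<close> out of one arc between the attracting
  fixed points and \<open>B\<close> moves \<open>\<alpha>\<^sup>+\<close> out of the other.\<close>

lemma q_pos:
  assumes "Iplus_exists A B"
  shows "q > 0"
proof (rule ccontr)
  assume "\<not> q > 0"
  with q_nonzero sgn_be have "be < 0"
    using mu_minus_inverse_pos by (auto simp: be_def divide_less_0_iff)
  have D: "cross2 a_att b_att \<noteq> 0" "cross2 (- a_att) b_att \<noteq> 0"
    using al_ne_be independent by (simp_all add: cross2_a_att_b_att)
  have "r * be < 0" using r_pos \<open>be < 0\<close> by (simp add: mult_pos_neg)
  then have "(r * be) * (1/lam) < 0" using lam_pos by (simp add: divide_neg_pos)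
  then have not_A: "\<not> invariant2 A B (proj_of ` cone2 a_att b_att)"
    using cone2_not_invariant[OF D(1) right_in_cone2 A_b_att]
    by (simp add: invariant2_def mob_eq_mob_real)
  have "real_mat B *v (- a_att) = - (real_mat B *v a_att)"
    by (simp add: vec2_eq_iff)
  then have "real_mat B *v (- a_att) = (1/mu) *\<^sub>R (- a_att) + (1/mu - mu) *\<^sub>R b_att"
    using B_a_att by (simp add: algebra_simps)
  moreover have "(1/mu) * (1/mu - mu) < 0"
    by (intro mult_pos_neg) (use mu_pos mu_minus_inverse_pos in auto)
  ultimately have not_B: "\<not> invariant2 A B (proj_of ` cone2 (- a_att) b_att)"
    using cone2_not_invariant[OF D(2) left_in_cone2]
    by (simp add: invariant2_def mob_eq_mob_real)
  have "att_fp A \<noteq> att_fp B"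
    using D(1) a_att_nonzero b_att_nonzero by (simp add: att_fp_A att_fp_B proj_of_eq_iff)
  with assms not_A not_B ccw_int_cases[OF D(1)] show False
    unfolding Iplus_exists_def att_fp_A att_fp_B by auto
qed

text \<open>If \<open>be < al\<close>, the arcs from \<open>\<alpha>\<^sup>+\<close> to \<open>\<beta>\<^sup>-\<close> and from \<open>\<alpha>\<^sup>-\<close> to \<open>\<beta>\<^sup>+\<close>
  witness that \<open>A, B\<^sup>-\<^sup>1\<close> is coherently oriented.\<close>

lemma al_less_be:
  assumes "q > 0" and "\<not> coherently_oriented A (inv2 B)"
  shows "al < be"
proof (rule ccontr)
  assume "\<not> al < be"
  with al_ne_be have "be < al" by simp
  have "be > 0" using assms(1) sgn_be by simp
  have D_plus: "cross2 a_att b_rep \<noteq> 0" and D_minus: "cross2 a_rep b_att \<noteq> 0"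
    using independent \<open>be > 0\<close>
    by (simp_all add: a_att_def b_att_def cross2_commute[of a_rep b_rep])
  have "invariant2 A (inv2 B) (proj_of ` cone2 a_att b_rep)"
    unfolding invariant2_def mob_eq_mob_real
  proof
    show "mob_real (real_mat A) ` proj_of ` cone2 a_att b_rep \<subseteq> proj_of ` cone2 a_att b_rep"
      by (rule cone2_invariant[OF D_plus det_nonzero(1), of lam 0 r "1/lam"])
        (use A_a_att A_b_rep_att r_pos lam_pos in simp_all)
    show "mob_real (real_mat (inv2 B)) ` proj_of ` cone2 a_att b_rep \<subseteq> proj_of ` cone2 a_att b_rep"
      by (rule cone2_invariant[OF D_plus det_nonzero(4), of "1/mu" "(mu - 1/mu) * (al - be)" 0 mu])
        (use inv2_B_a_att inv2_B_b_rep mu_pos mu_minus_inverse_pos \<open>be < al\<close> in simp_all)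
  qed
  moreover have "invariant2 (inv2 A) B (proj_of ` cone2 a_rep b_att)"
    unfolding invariant2_def mob_eq_mob_real
  proof
    show "mob_real (real_mat (inv2 A)) ` proj_of ` cone2 a_rep b_att \<subseteq> proj_of ` cone2 a_rep b_att"
      by (rule cone2_invariant[OF D_minus det_nonzero(3), of lam 0 "r * (al - be)" "1/lam"])
        (use inv2_A_a_rep inv2_A_b_att r_pos lam_pos \<open>be < al\<close> in simp_all)
    show "mob_real (real_mat B) ` proj_of ` cone2 a_rep b_att \<subseteq> proj_of ` cone2 a_rep b_att"
      by (rule cone2_invariant[OF D_minus det_nonzero(2), of "1/mu" "mu - 1/mu" 0 mu])
        (use B_a_rep_att B_b_att mu_pos mu_minus_inverse_pos in simp_all)
  qed
  moreover have "att_fp (inv2 B) = proj_of b_rep" "rep_fp (inv2 B) = proj_of b_att"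
    using rep_fp_B att_fp_B by (simp_all add: rep_fp_def)
  ultimately have "coherently_oriented A (inv2 B)"
    using ccw_int_cases[OF D_plus] ccw_int_cases[OF D_minus]
    unfolding coherently_oriented_def Iplus_exists_def Iminus_exists_def att_fp_A rep_fp_A
    by (auto simp: cone2_commute)
  with assms(2) show False ..
qed

end

lemma eigenframe_of_eigenvectors:
  assumes A: "SL2Z A" and B: "SL2Z B" and noncommuting: "A ** B \<noteq> B ** A"
    and lam: "lam \<ge> 1" "real_of_int (trace A) = lam + 1/lam"
    and mu: "mu > 1" "real_of_int (trace B) = mu + 1/mu"
    and a_rep: "a_rep \<noteq> 0" "real_mat A *v a_rep = (1/lam) *\<^sub>R a_rep"
    and b: "b \<noteq> 0" "real_mat B *v b = (1/mu) *\<^sub>R b"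
  obtains r q b_rep where "eigenframe A B lam mu r q a_rep b_rep"
proof -
  have "trace B \<noteq> 2" "trace B \<noteq> -2"
    using mu add_divide_self_gt_2[of mu] by auto
  note no_common = no_common_eigenvector[OF B this noncommuting]
  have D: "cross2 b a_rep \<noteq> 0"
    using eigenvector_parallel[OF b] a_rep no_common by blast
  have "cross2 b (real_mat A *v b) \<noteq> 0"
    using cross2_eq_0_imp_parallel[OF b(1)] b no_common by blast
  then obtain b_rep r where b_rep: "b_rep = b \<or> b_rep = - b" and "r > 0"
    and A_b_rep: "real_mat A *v b_rep = lam *\<^sub>R b_rep + r *\<^sub>R a_rep"
    using eigenbasis_action_pos[OF SL2Z_det_real_mat[OF A] D a_rep(2)] by auto
  have D': "cross2 b_rep a_rep \<noteq> 0" "cross2 a_rep b_rep \<noteq> 0"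
    using b_rep D by (auto simp: cross2_commute[of a_rep])
  have B_b_rep: "real_mat B *v b_rep = (1/mu) *\<^sub>R b_rep"
    using b_rep b(2) by (auto simp: matrix_vector_mult_uminus_right)
  define q where "q = cross2 a_rep (real_mat B *v a_rep) / cross2 a_rep b_rep"
  have B_a_rep: "real_mat B *v a_rep = mu *\<^sub>R a_rep + q *\<^sub>R b_rep"
    using eigenbasis_action[OF SL2Z_det_real_mat[OF B] D'(2) B_b_rep] by (simp add: q_def)
  moreover have "q \<noteq> 0"
  proof
    assume "q = 0"
    with B_a_rep have "real_mat B *v a_rep = mu *\<^sub>R a_rep" by simp
    with a_rep no_common show False by blast
  qed
  ultimately have "eigenframe A B lam mu r q a_rep b_rep"
    using A B noncommuting lam mu D' a_rep A_b_rep \<open>r > 0\<close> B_b_rep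
    by unfold_locales simp_all
  then show ?thesis ..
qed

lemma eigenframe_exists:
  assumes A: "SL2Z A" and B: "SL2Z B" and "A ** B \<noteq> B ** A"
    and "2 \<le> trace A" and "trace A < trace B"
  obtains lam mu r q a_rep b_rep where "eigenframe A B lam mu r q a_rep b_rep"
proof -
  have "real_of_int (trace A) \<ge> 2" "real_of_int (trace B) > 2"
    using assms(4,5) by simp_all
  then obtain lam mu where lam: "lam \<ge> 1" "real_of_int (trace A) = lam + 1/lam"
    and mu: "mu > 1" "real_of_int (trace B) = mu + 1/mu"
    using obtain_add_divide_self_eq less_imp_le by metis
  have "real_mat A \<noteq> mat 1" "real_mat B \<noteq> mat 1"
    using assms(3) by (auto simp: real_mat_eq_1_iff)
  moreover have "trace (real_mat A) = lam + 1/lam" "trace (real_mat B) = mu + 1/mu"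
    using lam(2) mu(2) by (simp_all add: trace_real_mat)
  ultimately obtain a_rep b where "a_rep \<noteq> 0" "real_mat A *v a_rep = (1/lam) *\<^sub>R a_rep"
    and "b \<noteq> 0" "real_mat B *v b = (1/mu) *\<^sub>R b"
    using eigenvector_exists[OF SL2Z_det_real_mat[OF A] _ lam(1)]
      eigenvector_exists[OF SL2Z_det_real_mat[OF B] _ less_imp_le[OF mu(1)]] by metis
  then obtain r q b_rep where "eigenframe A B lam mu r q a_rep b_rep"
    by (rule eigenframe_of_eigenvectors[OF A B assms(3) lam mu])
  then show ?thesis by (rule that)
qed

section \<open>Trace growth in an adapted basis\<close>

definition nonneg_mat :: "real^2^2 \<Rightarrow> bool" where
  "nonneg_mat M \<longleftrightarrow> M$1$1 \<ge> 0 \<and> M$1$2 \<ge> 0 \<and> M$2$1 \<ge> 0 \<and> M$2$2 \<ge> 0"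

definition preserves :: "(real^2 \<Rightarrow> bool) \<Rightarrow> real^2^2 \<Rightarrow> bool" where
  "preserves S M \<longleftrightarrow> (\<forall>v. S v \<longrightarrow> S (M *v v))"

definition cone_ge :: "real \<Rightarrow> real^2 \<Rightarrow> bool" where
  "cone_ge al v \<longleftrightarrow> v$2 \<ge> 0 \<and> al * v$2 \<le> v$1"

definition cone_le :: "real \<Rightarrow> real^2 \<Rightarrow> bool" where
  "cone_le be v \<longleftrightarrow> v$1 \<ge> 0 \<and> v$1 \<le> be * v$2"

definition adapted :: "real \<Rightarrow> real \<Rightarrow> real^2^2 \<Rightarrow> bool" where
  "adapted al be M \<longleftrightarrow>
     nonneg_mat M \<and> det M = 1 \<and> preserves (cone_ge al) M \<and> preserves (cone_le be) M"

lemma adapted_1: "adapted al be (mat 1)"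
  by (simp add: adapted_def preserves_def nonneg_mat_def mat_1_nth)

lemma adapted_mult: "adapted al be X \<Longrightarrow> adapted al be M \<Longrightarrow> adapted al be (X ** M)"
  by (simp add: adapted_def preserves_def nonneg_mat_def det_mul
      matrix_vector_mul_assoc[symmetric] del: matrix_vector_mult_2)

lemma adapted_diagonal_pos:
  assumes "adapted al be M"
  shows "M$1$1 > 0" "M$2$2 > 0"
proof -
  have "M$1$1 * M$2$2 = 1 + M$1$2 * M$2$1" and "M$1$2 * M$2$1 \<ge> 0"
    using assms by (simp_all add: adapted_def nonneg_mat_def det_2)
  then have "M$1$1 * M$2$2 > 0" by linarith
  with assms show "M$1$1 > 0" "M$2$2 > 0"
    by (auto simp: adapted_def nonneg_mat_def zero_less_mult_iff)
qed

definition lower_tri :: "real \<Rightarrow> real \<Rightarrow> real^2^2" where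
  "lower_tri l r = mat2 l 0 r (1/l)"

definition upper_tri :: "real \<Rightarrow> real \<Rightarrow> real^2^2" where
  "upper_tri m q = mat2 (1/m) q 0 m"

text \<open>In the eigenframe of a well-oriented pair, \<open>A\<close> and \<open>B\<close> become \<open>Ap\<close> and \<open>Bp\<close>
  below, whose attracting eigendirections are \<open>(al, 1)\<close> and \<open>(be, 1)\<close>.\<close>

locale positive_pair =
  fixes lam mu r al be :: real
  assumes lam: "lam \<ge> 1" and mu: "mu > 1" and r_pos: "r > 0"
    and r_al: "r * al = lam - 1/lam" and al_less_be: "al < be"
begin

abbreviation "Ap \<equiv> lower_tri lam r"
abbreviation "Bp \<equiv> upper_tri mu (be * (mu - 1/mu))"

lemma lam_pos: "lam > 0" and mu_pos: "mu > 0" and mu_minus_inverse_pos: "mu - 1/mu > 0"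
  using lam mu diff_divide_self_pos[OF mu] by simp_all

lemma al_nonneg: "al \<ge> 0"
proof -
  have "r * al \<ge> 0" using r_al diff_divide_self_nonneg[OF lam] by simp
  with r_pos show ?thesis by (simp add: zero_le_mult_iff)
qed

lemma be_pos: "be > 0"
  using al_nonneg al_less_be by simp

lemma adapted_Ap: "adapted al be Ap"
  unfolding adapted_def preserves_def
proof (intro conjI allI impI)
  show "nonneg_mat Ap" "det Ap = 1"
    using lam_pos r_pos by (simp_all add: lower_tri_def nonneg_mat_def det_2)
next
  fix v assume "cone_ge al v"
  then have v2: "v$2 \<ge> 0" and v1: "v$1 - al * v$2 \<ge> 0" by (simp_all add: cone_ge_def)
  then have "v$1 \<ge> 0" using al_nonneg by (meson diff_ge_0_iff_ge mult_nonneg_nonneg order_trans)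
  have "lam * v$1 - al * (r * v$1 + v$2 / lam) = (v$1 - al * v$2) / lam"
    using lam_pos r_al by (simp add: field_simps; algebra)
  with v1 v2 \<open>v$1 \<ge> 0\<close> r_pos lam_pos show "cone_ge al (Ap *v v)"
    by (simp add: cone_ge_def lower_tri_def algebra_simps)
next
  fix v assume "cone_le be v"
  then have v1: "v$1 \<ge> 0" and v2: "be * v$2 - v$1 \<ge> 0" by (simp_all add: cone_le_def)
  have "be * (r * v$1 + v$2 / lam) - lam * v$1 = r * (be - al) * v$1 + (be * v$2 - v$1) / lam"
    using lam_pos r_al by (simp add: field_simps; algebra)
  moreover have "r * (be - al) * v$1 \<ge> 0" using r_pos al_less_be v1 by simp
  moreover have "(be * v$2 - v$1) / lam \<ge> 0" using v2 lam_pos by simp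
  ultimately have "be * (r * v$1 + v$2 / lam) - lam * v$1 \<ge> 0" by linarith
  then show "cone_le be (Ap *v v)"
    using v1 lam_pos by (simp add: cone_le_def lower_tri_def algebra_simps)
qed

lemma adapted_Bp: "adapted al be Bp"
  unfolding adapted_def preserves_def
proof (intro conjI allI impI)
  show "nonneg_mat Bp" "det Bp = 1"
    using mu_pos be_pos mu_minus_inverse_pos by (simp_all add: upper_tri_def nonneg_mat_def det_2)
next
  fix v assume "cone_ge al v"
  then have v2: "v$2 \<ge> 0" and v1: "v$1 - al * v$2 \<ge> 0" by (simp_all add: cone_ge_def)
  have "v$1 / mu + be * (mu - 1/mu) * v$2 - al * (mu * v$2)
      = (v$1 - al * v$2) / mu + (mu - 1/mu) * (be - al) * v$2"
    using mu_pos by (simp add: field_simps; algebra)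
  moreover have "(mu - 1/mu) * (be - al) * v$2 \<ge> 0"
    using mu_minus_inverse_pos al_less_be v2 by simp
  moreover have "(v$1 - al * v$2) / mu \<ge> 0" using v1 mu_pos by simp
  ultimately have "v$1 / mu + be * (mu - 1/mu) * v$2 - al * (mu * v$2) \<ge> 0" by linarith
  then show "cone_ge al (Bp *v v)"
    using v2 mu_pos by (simp add: cone_ge_def upper_tri_def algebra_simps)
next
  fix v assume "cone_le be v"
  then have v1: "v$1 \<ge> 0" and v2: "be * v$2 - v$1 \<ge> 0" by (simp_all add: cone_le_def)
  then have "be * v$2 \<ge> 0" by simp
  then have "v$2 \<ge> 0" using be_pos by (simp add: zero_le_mult_iff)
  have "be * (mu * v$2) - (v$1 / mu + be * (mu - 1/mu) * v$2) = (be * v$2 - v$1) / mu"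
    using mu_pos by (simp add: field_simps; algebra)
  then have "be * (mu * v$2) - (v$1 / mu + be * (mu - 1/mu) * v$2) \<ge> 0"
    using v2 mu_pos by simp
  moreover have "v$1 / mu + be * (mu - 1/mu) * v$2 \<ge> 0"
    using v1 \<open>v$2 \<ge> 0\<close> mu_pos be_pos mu_minus_inverse_pos by simp
  ultimately show "cone_le be (Bp *v v)"
    by (simp add: cone_le_def upper_tri_def algebra_simps)
qed

text \<open>Testing the invariance of \<open>cone_ge al\<close> on its boundary ray \<open>(al, 1)\<close> bounds the
  entry \<open>M$2$2\<close>, which is the only one that enters \<open>trace (Ap ** M) - trace M\<close> negatively.\<close>

lemma trace_Ap_mult:
  assumes "adapted al be M"
  shows "trace M \<le> trace (Ap ** M)"
    and "lam > 1 \<or> M$1$2 > 0 \<Longrightarrow> trace M < trace (Ap ** M)"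
proof -
  have "M$1$1 > 0" "M$1$2 \<ge> 0" "M$2$1 \<ge> 0"
    using assms adapted_diagonal_pos by (auto simp: adapted_def nonneg_mat_def)
  have "cone_ge al (vector [al, 1])" by (simp add: cone_ge_def)
  then have "cone_ge al (M *v vector [al, 1])"
    using assms by (simp add: adapted_def preserves_def)
  then have boundary: "M$1$1 * al + M$1$2 - al * (M$2$1 * al + M$2$2) \<ge> 0"
    by (simp add: cone_ge_def)
  have "(lam + 1) * (trace (Ap ** M) - trace M)
      = (lam + 1) * (lam + 1/lam - 2) * M$1$1 + r * lam * M$1$2
        + r * ((M$1$1 * al + M$1$2 - al * (M$2$1 * al + M$2$2)) + al * al * M$2$1)"
    using lam_pos r_al by (simp add: lower_tri_def trace_2 field_simps; algebra)
  moreover have "r * ((M$1$1 * al + M$1$2 - al * (M$2$1 * al + M$2$2)) + al * al * M$2$1) \<ge> 0"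
    using boundary \<open>M$2$1 \<ge> 0\<close> r_pos by simp
  moreover have "(lam + 1) * (lam + 1/lam - 2) * M$1$1 \<ge> 0"
    "lam > 1 \<Longrightarrow> (lam + 1) * (lam + 1/lam - 2) * M$1$1 > 0"
    using add_divide_self_ge_2[OF lam_pos] add_divide_self_gt_2[OF lam_pos] lam_pos \<open>M$1$1 > 0\<close>
    by simp_all
  moreover have "r * lam * M$1$2 \<ge> 0" "M$1$2 > 0 \<Longrightarrow> r * lam * M$1$2 > 0"
    using r_pos lam_pos \<open>M$1$2 \<ge> 0\<close> by simp_all
  ultimately have "(lam + 1) * (trace (Ap ** M) - trace M) \<ge> 0"
    and "lam > 1 \<or> M$1$2 > 0 \<Longrightarrow> (lam + 1) * (trace (Ap ** M) - trace M) > 0"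
    by linarith+
  moreover have "lam + 1 > 0" using lam_pos by simp
  ultimately show "trace M \<le> trace (Ap ** M)" and "lam > 1 \<or> M$1$2 > 0 \<Longrightarrow> trace M < trace (Ap ** M)"
    by (simp_all add: zero_le_mult_iff zero_less_mult_iff)
qed

lemma trace_Bp_mult:
  assumes "adapted al be M"
  shows "trace M < trace (Bp ** M)"
proof -
  have "M$2$2 > 0" "M$2$1 \<ge> 0" "M$1$2 \<ge> 0"
    using assms adapted_diagonal_pos by (auto simp: adapted_def nonneg_mat_def)
  have "cone_le be (vector [be, 1])" using be_pos by (simp add: cone_le_def)
  then have "cone_le be (M *v vector [be, 1])"
    using assms by (simp add: adapted_def preserves_def)
  then have boundary: "be * (M$2$1 * be + M$2$2) - (M$1$1 * be + M$1$2) \<ge> 0"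
    by (simp add: cone_le_def)
  have "be * (mu + 1) * (trace (Bp ** M) - trace M)
      = be * (mu + 1) * (mu + 1/mu - 2) * M$2$2 + be * (be * (mu - 1/mu)) * mu * M$2$1
        + (mu - 1/mu) * ((be * (M$2$1 * be + M$2$2) - (M$1$1 * be + M$1$2)) + M$1$2)"
    using mu_pos by (simp add: upper_tri_def trace_2 field_simps; algebra)
  moreover have "(mu - 1/mu) * ((be * (M$2$1 * be + M$2$2) - (M$1$1 * be + M$1$2)) + M$1$2) \<ge> 0"
    using boundary \<open>M$1$2 \<ge> 0\<close> mu_minus_inverse_pos by simp
  moreover have "be * (mu + 1) * (mu + 1/mu - 2) * M$2$2 > 0"
    using be_pos mu_pos add_divide_self_gt_2[OF mu_pos] mu \<open>M$2$2 > 0\<close> by simp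
  moreover have "be * (be * (mu - 1/mu)) * mu * M$2$1 \<ge> 0"
    using be_pos mu_pos mu_minus_inverse_pos \<open>M$2$1 \<ge> 0\<close> by simp
  ultimately have "be * (mu + 1) * (trace (Bp ** M) - trace M) > 0" by linarith
  moreover have "be * (mu + 1) > 0" using be_pos mu_pos by simp
  ultimately show ?thesis by (simp add: zero_less_mult_iff)
qed

end

section \<open>Change of basis\<close>

definition frame_mat :: "real^2 \<Rightarrow> real^2 \<Rightarrow> real^2^2" where
  "frame_mat v w = mat2 (v$1) (w$1) (v$2) (w$2)"

definition frame_inv :: "real^2 \<Rightarrow> real^2 \<Rightarrow> real^2^2" where
  "frame_inv v w = mat2 (w$2 / cross2 v w) (- w$1 / cross2 v w) (- v$2 / cross2 v w) (v$1 / cross2 v w)"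

definition in_frame :: "real^2 \<Rightarrow> real^2 \<Rightarrow> real^2^2 \<Rightarrow> real^2^2" where
  "in_frame v w X = frame_inv v w ** X ** frame_mat v w"

lemma frame_inv_mult: "cross2 v w \<noteq> 0 \<Longrightarrow> frame_inv v w ** frame_mat v w = mat 1"
  by (simp add: mat2_eq_iff frame_mat_def frame_inv_def mat_1_nth field_simps)
    (simp_all add: cross2_def algebra_simps)

lemma frame_mult_inv: "cross2 v w \<noteq> 0 \<Longrightarrow> frame_mat v w ** frame_inv v w = mat 1"
  by (simp add: mat2_eq_iff frame_mat_def frame_inv_def mat_1_nth field_simps)
    (simp_all add: cross2_def algebra_simps)

lemma in_frame_mult:
  assumes "cross2 v w \<noteq> 0"
  shows "in_frame v w (X ** Y) = in_frame v w X ** in_frame v w Y"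
proof -
  have "in_frame v w X ** in_frame v w Y =
      frame_inv v w ** X ** (frame_mat v w ** frame_inv v w) ** Y ** frame_mat v w"
    by (simp add: in_frame_def matrix_mul_assoc)
  then show ?thesis by (simp add: frame_mult_inv[OF assms] in_frame_def matrix_mul_assoc)
qed

lemma in_frame_1: "cross2 v w \<noteq> 0 \<Longrightarrow> in_frame v w (mat 1) = mat 1"
  by (simp add: in_frame_def frame_inv_mult)

lemma trace_in_frame:
  assumes "cross2 v w \<noteq> 0"
  shows "trace (in_frame v w X) = trace X"
proof -
  have "trace (in_frame v w X) = trace (frame_mat v w ** (frame_inv v w ** X))"
    unfolding in_frame_def by (rule trace_mul_sym)
  also have "\<dots> = trace X" by (simp add: matrix_mul_assoc frame_mult_inv[OF assms])
  finally show ?thesis .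
qed

lemma in_frame_eq_mat2:
  assumes "cross2 v w \<noteq> 0" and "X *v v = a *\<^sub>R v + c *\<^sub>R w" and "X *v w = b *\<^sub>R v + d *\<^sub>R w"
  shows "in_frame v w X = mat2 a b c d"
proof -
  have "X ** frame_mat v w = frame_mat v w ** mat2 a b c d"
    using assms(2,3) by (simp add: vec2_eq_iff mat2_eq_iff frame_mat_def algebra_simps)
  then have "in_frame v w X = (frame_inv v w ** frame_mat v w) ** mat2 a b c d"
    by (simp add: in_frame_def matrix_mul_assoc[symmetric])
  then show ?thesis by (simp add: frame_inv_mult[OF assms(1)])
qed

section \<open>Words\<close>

lemma phi_Nil [simp]: "phi A B [] = mat 1"
  by (simp add: phi_def)

lemma phi_Cons [simp]: "phi A B (l # w) = letter_mat A B l ** phi A B w"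
  by (simp add: phi_def)

lemma phi_append: "phi A B (u @ v) = phi A B u ** phi A B v"
  by (induction u) (simp_all add: matrix_mul_assoc)

lemma trw_append_commute: "trw A B (u @ v) = trw A B (v @ u)"
  unfolding trw_def phi_append by (rule trace_mul_sym)

lemma subseq_delete_one:
  "subseq u w \<Longrightarrow> u \<noteq> w \<Longrightarrow> \<exists>p x s. w = p @ x # s \<and> subseq u (p @ s)"
proof (induction u w rule: list_emb.induct)
  case (list_emb_Nil ys)
  then obtain y ys' where "ys = y # ys'" by (cases ys) auto
  then show ?case by (intro exI[of _ "[]"]) auto
next
  case (list_emb_Cons xs ys y)
  then show ?case by (intro exI[of _ "[]"]) auto
next
  case (list_emb_Cons2 x y xs ys)
  then obtain p z s where "ys = p @ z # s" "subseq xs (p @ s)" by auto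
  with list_emb_Cons2 show ?case by (intro exI[of _ "y # p"] exI[of _ z] exI[of _ s]) auto
qed

lemma subseq_mono_if_insert_mono:
  fixes f :: "'a list \<Rightarrow> 'b::order"
  assumes insert: "\<And>p x s. f (p @ s) \<le> f (p @ x # s)" and "subseq u w"
  shows "f u \<le> f w"
  using assms(2)
proof (induction "length w" arbitrary: w rule: less_induct)
  case less
  show ?case
  proof (cases "u = w")
    case False
    with less.prems obtain p x s where w: "w = p @ x # s" and "subseq u (p @ s)"
      using subseq_delete_one by blast
    with less.hyps have "f u \<le> f (p @ s)" by simp
    also have "\<dots> \<le> f w" using insert w by simp
    finally show ?thesis .
  qed simp
qed

section \<open>Inserting a letter into a word\<close>

context eigenframe
begin

lemma in_frame_A: "in_frame b_rep a_rep (real_mat A) = lower_tri lam r"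
  unfolding lower_tri_def
  by (rule in_frame_eq_mat2[OF independent]) (simp_all add: A_b_rep A_a_rep)

lemma in_frame_B: "in_frame b_rep a_rep (real_mat B) = upper_tri mu (be * (mu - 1/mu))"
  unfolding upper_tri_def
  by (rule in_frame_eq_mat2[OF independent]) (simp_all add: B_b_rep B_a_rep' add.commute)

lemma positive_pair:
  assumes "al < be"
  shows "positive_pair lam mu r al be"
  using lam mu r_pos r_al assms by unfold_locales

lemma in_frame_word:
  assumes "al < be"
  shows "adapted al be (in_frame b_rep a_rep (real_mat (phi A B w))) \<and>
    (Lb \<in> set w \<longrightarrow> in_frame b_rep a_rep (real_mat (phi A B w)) $1$2 > 0)"
proof (induction w)
  case Nil
  show ?case by (simp add: real_mat_1 in_frame_1[OF independent] adapted_1)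
next
  case (Cons l w)
  interpret positive_pair lam mu r al be
    using positive_pair[OF assms] .
  define M where "M = in_frame b_rep a_rep (real_mat (phi A B w))"
  have M: "adapted al be M" and "Lb \<in> set w \<Longrightarrow> M$1$2 > 0"
    using Cons by (simp_all add: M_def)
  have "M$2$2 > 0" "M$1$2 \<ge> 0"
    using M adapted_diagonal_pos by (auto simp: adapted_def nonneg_mat_def)
  have word: "in_frame b_rep a_rep (real_mat (phi A B (l # w))) =
      in_frame b_rep a_rep (real_mat (letter_mat A B l)) ** M"
    by (simp add: M_def real_mat_mult in_frame_mult[OF independent])
  show ?case
  proof (cases l)
    case La
    with word have eq: "in_frame b_rep a_rep (real_mat (phi A B (l # w))) = Ap ** M"
      by (simp add: letter_mat_def in_frame_A)
    show ?thesis
      unfolding eq using adapted_mult[OF adapted_Ap M] \<open>Lb \<in> set w \<Longrightarrow> M$1$2 > 0\<close> La lam_pos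
      by (simp add: lower_tri_def)
  next
    case Lb
    with word have eq: "in_frame b_rep a_rep (real_mat (phi A B (l # w))) = Bp ** M"
      by (simp add: letter_mat_def in_frame_B)
    have "(Bp ** M)$1$2 > 0"
      using \<open>M$2$2 > 0\<close> \<open>M$1$2 \<ge> 0\<close> mu_pos be_pos mu_minus_inverse_pos
      by (simp add: upper_tri_def add_nonneg_pos)
    then show ?thesis
      unfolding eq using adapted_mult[OF adapted_Bp M] by simp
  qed
qed

lemma trw_Cons:
  assumes "al < be"
  shows "trw A B w \<le> trw A B (x # w)"
    and "\<not> (x = La \<and> lam = 1 \<and> Lb \<notin> set w) \<Longrightarrow> trw A B w < trw A B (x # w)"
proof -
  interpret positive_pair lam mu r al be
    using positive_pair[OF assms] .
  define M where "M = in_frame b_rep a_rep (real_mat (phi A B w))"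
  have M: "adapted al be M" and "Lb \<in> set w \<Longrightarrow> M$1$2 > 0"
    using in_frame_word[OF assms] by (simp_all add: M_def)
  have trw_in_frame: "real_of_int (trw A B v) = trace (in_frame b_rep a_rep (real_mat (phi A B v)))" for v
    by (simp add: trw_def trace_in_frame[OF independent] trace_real_mat)
  have "real_of_int (trw A B (x # w)) = trace (in_frame b_rep a_rep (real_mat (letter_mat A B x)) ** M)"
    by (simp add: trw_in_frame M_def real_mat_mult in_frame_mult[OF independent])
  moreover have "real_of_int (trw A B w) = trace M"
    by (simp add: trw_in_frame M_def)
  ultimately have "real_of_int (trw A B w) \<le> real_of_int (trw A B (x # w)) \<and>
      (\<not> (x = La \<and> lam = 1 \<and> Lb \<notin> set w) \<longrightarrow> real_of_int (trw A B w) < real_of_int (trw A B (x # w)))"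
    using trace_Ap_mult[OF M] trace_Bp_mult[OF M] lam \<open>Lb \<in> set w \<Longrightarrow> M$1$2 > 0\<close>
    by (cases x) (auto simp: letter_mat_def in_frame_A in_frame_B)
  then show "trw A B w \<le> trw A B (x # w)"
    and "\<not> (x = La \<and> lam = 1 \<and> Lb \<notin> set w) \<Longrightarrow> trw A B w < trw A B (x # w)"
    by simp_all
qed

end

lemma trw_insert_letter:
  assumes "SL2Z A" and "SL2Z B" and "A ** B \<noteq> B ** A" and "well_oriented A B"
    and "2 \<le> trace A" and "trace A < trace B"
  shows "trw A B (p @ s) \<le> trw A B (p @ x # s)"
    and "\<not> (x = La \<and> parabolic A \<and> Lb \<notin> set (p @ s)) \<Longrightarrow> trw A B (p @ s) < trw A B (p @ x # s)"
proof -
  obtain lam mu r q a_rep b_rep where "eigenframe A B lam mu r q a_rep b_rep"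
    using eigenframe_exists[OF assms(1-3,5,6)] .
  then interpret eigenframe A B lam mu r q a_rep b_rep .
  have "q > 0" and "al < be"
    using assms(4) q_pos al_less_be by (auto simp: well_oriented_def coherently_oriented_def)
  have "parabolic A \<longleftrightarrow> lam = 1"
  proof
    assume "parabolic A"
    then have "lam + 1/lam = 2" using trace_A by (simp add: parabolic_def)
    then show "lam = 1" using add_divide_self_gt_2[OF lam_pos] by (cases "lam = 1") auto
  qed (use trace_A in \<open>simp add: parabolic_def\<close>)
  moreover have "trw A B (p @ x # s) = trw A B (x # (s @ p))" "trw A B (p @ s) = trw A B (s @ p)"
    using trw_append_commute[of A B p "x # s"] trw_append_commute[of A B p s] by simp_all
  ultimately show "trw A B (p @ s) \<le> trw A B (p @ x # s)"
    and "\<not> (x = La \<and> parabolic A \<and> Lb \<notin> set (p @ s)) \<Longrightarrow> trw A B (p @ s) < trw A B (p @ x # s)"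
    using trw_Cons[OF \<open>al < be\<close>, where w = "s @ p" and x = x] by auto
qed

theorem lemma5p2:
  fixes A B :: "int^2^2"
  assumes "SL2Z A" and "SL2Z B"
    and "A ** B \<noteq> B ** A"
    and "well_oriented A B"
    and "2 \<le> trace A" and "trace A < trace B"
  shows "(\<forall>w u. (trw A B w < trw A B u \<longleftrightarrow> trw A B w \<le> trw A B u - 1)) \<and>
         (\<forall>w u. strict_subseq u w \<longrightarrow>
           \<not> (parabolic A \<and> (\<exists>n. w = replicate n La)) \<longrightarrow> trw A B u < trw A B w)"
proof (intro conjI allI impI)
  fix w u
  show "trw A B w < trw A B u \<longleftrightarrow> trw A B w \<le> trw A B u - 1" by auto
next
  fix u w
  assume "strict_subseq u w" and exception: "\<not> (parabolic A \<and> (\<exists>n. w = replicate n La))"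
  from \<open>strict_subseq u w\<close> obtain p x s where w: "w = p @ x # s" and "subseq u (p @ s)"
    using subseq_delete_one unfolding strict_subseq_def by blast
  then have "trw A B u \<le> trw A B (p @ s)"
    using subseq_mono_if_insert_mono[where f = "trw A B", OF trw_insert_letter(1)[OF assms]]
    by blast
  also have "\<dots> < trw A B w"
  proof -
    have "\<not> (x = La \<and> parabolic A \<and> Lb \<notin> set (p @ s))"
    proof
      assume "x = La \<and> parabolic A \<and> Lb \<notin> set (p @ s)"
      then have "parabolic A" "\<forall>y \<in> set w. y = La"
        using w letter.exhaust by auto
      with exception show False using replicate_length_same by metis
    qed
    then show ?thesis using trw_insert_letter(2)[OF assms] w by blast
  qed
  finally show "trw A B u < trw A B w" .
qed

end
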